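(* Let $p$ and $r$ be primes with $r \mid (p-1)$, and if $r = 2$ assume moreover $4 \mid (p-1)$. Let $a \in \mathbb{F}_p$ be the element that is not an $r$-th power in $\mathbb{F}_p$ returned by the algorithm NonRthPower (defined in the context) with inputs $\mathbb{F}_p$ and $r$. Let $X_{r,i}$, $i \in \mathbb{Z}_{>0}$, be independent commuting indeterminates over $\mathbb{F}_p$ and define $$f_{r,1} := X_{r,1}^r - a,$$ $$f_{r,i} := X_{r,i}^r - X_{r,i-1} \quad \text{for } i \geq 2.$$ Then for each $l \in \mathbb{Z}_{>0}$ the sequence $((X_{r,i}, f_{r,i}),\ 1 \leq i \leq l)$ defines a tower of field extensions over $\mathbb{F}_p$ in which each step has degree $r$.
   Context: $\mathbb{F}_p = \mathbb{Z}/p\mathbb{Z}$ denotes the field with $p$ elements. Tower of field extensions: let $F$ be a field and $X_1,\ldots,X_l$ independent commuting indeterminates over $F$. For $i=1,\ldots,l$ let $f_i \in F[X_1,\ldots,X_{i-1}][X_i]$ be monic in the variable $X_i$. The sequence $((X_i,f_i),\ i=1,\ldots,l)$ defines a tower of (algebraic) field extensions over $F$ if for each $i=1,\ldots,l$ the residue class of $f_i$ in $F[X_1,\ldots,X_{i-1}][X_i]/(f_1,\ldots,f_{i-1}) = (F[X_1,\ldots,X_{i-1}]/(f_1,\ldots,f_{i-1}))[X_i]$ is irreducible. In that case one has a chain of fields $F = F_0 \leq F_1 \leq \cdots \leq F_l$ with $F_i = F[X_1,\ldots,X_i]/(f_1,\ldots,f_i)$, and the degree $[F_i:F_{i-1}]$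 is the degree of $f_i$ in $X_i$. StandardAffineShift: for integers $q>0$ and $i$, $\mathrm{StandardAffineShift}(q,i)$ is the integer $(m i + c) \bmod q$ (in the range $0,\ldots,q-1$), where $m$ is the largest integer with $m \leq \frac{4}{5}q$ and $\gcd(m,q)=1$, and $c$ is the largest integer $\leq \frac{2}{3}q$. Steinitz numbers on $\mathbb{F}_p$: the element $k + p\mathbb{Z}$ with $0 \leq k < p$ has Steinitz number $k$. Algorithm NonRthPower$(\mathbb{F}_p, r)$, for a prime $r$ dividing $p-1$: start with $i=0$ and $a = 0 \in \mathbb{F}_p$; while $a = 0$ or $a^{(p-1)/r} = 1$, increase $i$ by $1$ and set $a$ to the element of $\mathbb{F}_p$ with Steinitz number $\mathrm{StandardAffineShift}(p,i)$; when the loop ends, return $a$. *)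

theory Defs
  imports
    "HOL-Library.Poly_Mapping"
    "HOL-Library.While_Combinator"
    "HOL-Algebra.Algebra"
    "HOL-Algebra.Algebraic_Closure_Type"
    "Berlekamp_Zassenhaus.Finite_Field"
begin

text \<open>
  A polynomial in commuting indeterminates \<open>X\<^sub>1, X\<^sub>2, \<dots>\<close> is a finitely supported map from
  monomials (finitely supported exponent functions) to coefficients; with this representation the
  arithmetic of \<^type>\<open>poly_mapping\<close> is the arithmetic of polynomials.
\<close>

type_synonym 'a mpoly = "(nat \<Rightarrow>\<^sub>0 nat) \<Rightarrow>\<^sub>0 'a"

definition Const :: "'a::zero \<Rightarrow> 'a mpoly"
  where "Const c = Poly_Mapping.single 0 c"

definition Var :: "nat \<Rightarrow> 'a::zero_neq_one mpoly"
  where "Var i = Poly_Mapping.single (Poly_Mapping.single i 1) 1"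

text \<open>The ring \<open>F[X\<^sub>1, \<dots>, X\<^sub>n]\<close>, where \<open>F\<close> is the type \<open>'a\<close>.\<close>

definition mpoly_ring :: "nat \<Rightarrow> 'a::comm_ring_1 mpoly ring"
  where "mpoly_ring n =
    ring_of_type_algebra \<lparr>carrier := {f. \<forall>m\<in>Poly_Mapping.keys f. Poly_Mapping.keys m \<subseteq> {1..n}}\<rparr>"

definition deg_in :: "nat \<Rightarrow> 'a::zero mpoly \<Rightarrow> nat"
  where "deg_in i f = Max (insert 0 ((\<lambda>m. Poly_Mapping.lookup m i) ` Poly_Mapping.keys f))"

text \<open>The coefficient of \<open>X\<^sub>i\<^sup>k\<close> in \<open>f\<close>, itself a polynomial in the other indeterminates.\<close>

definition coeff_in :: "nat \<Rightarrow> nat \<Rightarrow> 'a::comm_monoid_add mpoly \<Rightarrow> 'a mpoly"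
  where "coeff_in i k f =
    (\<Sum>m\<in>{m \<in> Poly_Mapping.keys f. Poly_Mapping.lookup m i = k}.
       Poly_Mapping.single (m - Poly_Mapping.single i k) (Poly_Mapping.lookup f m))"

definition monic_in :: "nat \<Rightarrow> 'a::comm_semiring_1 mpoly \<Rightarrow> bool"
  where "monic_in i f \<longleftrightarrow> coeff_in i (deg_in i f) f = 1"

text \<open>
  \<open>tower_ideal f n k\<close> is the ideal \<open>(f\<^sub>1, \<dots>, f\<^sub>k)\<close> of \<open>F[X\<^sub>1, \<dots>, X\<^sub>n]\<close>, and \<open>tower_quot f n k\<close> is
  the quotient \<open>F[X\<^sub>1, \<dots>, X\<^sub>n]/(f\<^sub>1, \<dots>, f\<^sub>k)\<close>.  The ring \<open>(F[X\<^sub>1, \<dots>, X\<^bsub>i-1\<^esub>]/(f\<^sub>1, \<dots>, f\<^bsub>i-1\<^esub>))[X\<^sub>i]\<close>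
  is \<open>tower_quot f i (i - 1)\<close>, and \<open>F\<^sub>i\<close> is \<open>tower_quot f i i\<close>.
\<close>

definition tower_ideal :: "(nat \<Rightarrow> 'a::comm_ring_1 mpoly) \<Rightarrow> nat \<Rightarrow> nat \<Rightarrow> 'a mpoly set"
  where "tower_ideal f n k = genideal (mpoly_ring n) (f ` {1..k})"

definition tower_quot :: "(nat \<Rightarrow> 'a::comm_ring_1 mpoly) \<Rightarrow> nat \<Rightarrow> nat \<Rightarrow> 'a mpoly set ring"
  where "tower_quot f n k = mpoly_ring n Quot tower_ideal f n k"

definition residue_class ::
    "(nat \<Rightarrow> 'a::comm_ring_1 mpoly) \<Rightarrow> nat \<Rightarrow> nat \<Rightarrow> 'a mpoly \<Rightarrow> 'a mpoly set"
  where "residue_class f n k g = tower_ideal f n k +>\<^bsub>mpoly_ring n\<^esub> g"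

definition tower_of_field_extensions :: "nat \<Rightarrow> (nat \<Rightarrow> 'a::field mpoly) \<Rightarrow> bool"
  where "tower_of_field_extensions l f \<longleftrightarrow>
    (\<forall>i\<in>{1..l}. f i \<in> carrier (mpoly_ring i) \<and> monic_in i (f i) \<and>
       ring_irreducible\<^bsub>tower_quot f i (i - 1)\<^esub> (residue_class f i (i - 1) (f i)))"

text \<open>
  \<open>F\<^bsub>i-1\<^esub>\<close> as a subset of \<open>F\<^sub>i\<close>: its image under the canonical map, consisting of the classes of the
  polynomials in \<open>X\<^sub>1, \<dots>, X\<^bsub>i-1\<^esub>\<close>.
\<close>

definition tower_subfield :: "(nat \<Rightarrow> 'a::field mpoly) \<Rightarrow> nat \<Rightarrow> 'a mpoly set set"
  where "tower_subfield f i = residue_class f i i ` carrier (mpoly_ring (i - 1))"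

text \<open>\<open>F\<^bsub>i-1\<^esub> \<le> F\<^sub>i\<close> is an extension of fields with \<open>[F\<^sub>i : F\<^bsub>i-1\<^esub>] = d\<close>.\<close>

definition tower_step_degree :: "(nat \<Rightarrow> 'a::field mpoly) \<Rightarrow> nat \<Rightarrow> nat \<Rightarrow> bool"
  where "tower_step_degree f i d \<longleftrightarrow>
    field (tower_quot f i i) \<and> subfield (tower_subfield f i) (tower_quot f i i) \<and>
    ring.dimension (tower_quot f i i) d (tower_subfield f i) (carrier (tower_quot f i i))"

definition standard_affine_shift :: "int \<Rightarrow> int \<Rightarrow> int"
  where "standard_affine_shift q i =
    (let m = (GREATEST m::int. real_of_int m \<le> 4 / 5 * real_of_int q \<and> gcd m q = 1);
         c = \<lfloor>2 / 3 * real_of_int q\<rfloor>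
     in (m * i + c) mod q)"

text \<open>
  The element of \<open>\<int>/p\<int>\<close> with Steinitz number \<open>k\<close>, \<open>0 \<le> k < p\<close>, is the class \<open>of_int k\<close>.  The
  combinator \<^const>\<open>while\<close> is unspecified on loops that do not terminate, so any fact about the
  returned element rests on termination of the loop.
\<close>

definition NonRthPower :: "nat \<Rightarrow> 'p::prime_card mod_ring"
  where "NonRthPower r =
    snd (while (\<lambda>(i, a). a = 0 \<or> a ^ ((CARD('p) - 1) div r) = 1)
               (\<lambda>(i, a). (i + 1, of_int (standard_affine_shift (int CARD('p)) (i + 1))))
               (0 :: int, 0))"

end

theory Submission
  imports Defs "Berlekamp_Zassenhaus.Berlekamp_Type_Based"
begin

text \<open>
  Let \<open>\<alpha> 0 = a\<close>, and let \<open>\<alpha> (n + 1)\<close> be an \<open>r\<close>-th root of \<open>\<alpha> n\<close> in an algebraic closure of the prime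
  field \<open>F\<close> with \<open>p\<close> elements. Everything rests on one fact: \<open>\<alpha> n\<close> has degree \<open>r ^ n\<close> over \<open>F\<close>
  (\<open>no_small_relation\<close>). To see this, count conjugates. Put \<open>\<zeta> = \<alpha> n ^ (p - 1)\<close>. As \<open>a\<close> is not an
  \<open>r\<close>-th power, \<open>\<zeta>\<close> has order exactly \<open>r ^ n\<close>, and the \<open>d\<close>-fold Frobenius map multiplies \<open>\<alpha> n\<close> by
  \<open>\<zeta>\<close> to the power \<open>1 + p + \<dots> + p ^ (d - 1)\<close>. Because \<open>p\<close> is \<open>1\<close> modulo \<open>r\<close> (and modulo \<open>4\<close> if
  \<open>r = 2\<close>), this exponent is divisible by \<open>r ^ n\<close> only if \<open>d\<close> is
  (\<open>prime_power_dvd_of_dvd_geometric_sum\<close>). So the first \<open>r ^ n\<close> Frobenius conjugates are distinct.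

  The tower is compared with these roots by the evaluation map \<open>ev\<close> that sends \<open>X\<^sub>i\<close> to \<open>\<alpha> i\<close>. Modulo
  \<open>(f\<^sub>1, \<dots>, f\<^sub>n)\<close> every polynomial is congruent to one in \<open>X\<^sub>n\<close> alone of degree less than \<open>r ^ n\<close>, so by
  the degree of \<open>\<alpha> n\<close> this ideal is the kernel of \<open>ev\<close> on \<open>F[X\<^sub>1, \<dots>, X\<^sub>n]\<close> (\<open>mem_tower_ideal_iff\<close>) and
  \<open>F\<^sub>n\<close> is the finite field \<open>F[\<alpha> n]\<close>. In the same way \<open>(f\<^sub>1, \<dots>, f\<^bsub>n-1\<^esub>)\<close> is the kernel of a map into
  a polynomial ring over the algebraic closure that keeps \<open>X\<^sub>n\<close> free
  (\<open>mem_tower_ideal_last_iff\<close>), so that the quotient is a domain, in which the class of \<open>f\<^sub>n\<close> is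
  irreducible because the quotient by it is a domain again (\<open>ring_irreducible_residue_class\<close>).

  Finally \<open>1, X\<^sub>n, \<dots>, X\<^sub>n\<^bsup>r-1\<^esup>\<close> is a basis of \<open>F\<^sub>n\<close> over \<open>F\<^bsub>n-1\<^esub>\<close>: these powers span since \<open>X\<^sub>n\<^sup>r\<close> is
  congruent to \<open>X\<^bsub>n-1\<^esub>\<close>, and a linear relation between them would again be a polynomial relation
  for \<open>\<alpha> n\<close> of degree less than \<open>r ^ n\<close> (\<open>powers_independent\<close>). The element \<open>a\<close> returned by the
  search qualifies because the shift runs through all residues and some residue is not an \<open>r\<close>-th
  power (\<open>NonRthPower_correct\<close>).
\<close>

section \<open>Geometric sums modulo powers of a prime\<close>

lemma geometric_sum_mult:
  fixes q :: nat
  shows "(\<Sum>i<m * n. q ^ i) = (\<Sum>i<m. (q ^ n) ^ i) * (\<Sum>i<n. q ^ i)"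
proof (induction m)
  case (Suc m)
  have "{..<Suc m * n} = {..<m * n} \<union> {m * n..<m * n + n}" by auto
  then have "(\<Sum>i<Suc m * n. q ^ i) = (\<Sum>i<m * n. q ^ i) + (\<Sum>i=m * n..<m * n + n. q ^ i)"
    by (simp add: sum.union_disjoint ivl_disj_int)
  also have "(\<Sum>i=m * n..<m * n + n. q ^ i) = (\<Sum>i<n. q ^ (i + m * n))"
    using sum.shift_bounds_nat_ivl[of "\<lambda>i. q ^ i" 0 "m * n" n] by (simp add: lessThan_atLeast0 add.commute)
  also have "\<dots> = (q ^ n) ^ m * (\<Sum>i<n. q ^ i)"
    by (simp add: power_add sum_distrib_right mult.commute flip: power_mult)
  finally show ?case
    using Suc by (simp add: algebra_simps)
qed simp

lemma power_eq_geometric_sum: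
  fixes q :: nat
  assumes "q > 0"
  shows "q ^ n = (q - 1) * (\<Sum>i<n. q ^ i) + 1"
proof (induction n)
  case (Suc n)
  obtain t where q: "q = Suc t" using assms by (cases q) auto
  have "q ^ Suc n = q ^ n + (q - 1) * q ^ n" by (simp add: q)
  also have "q ^ n = (q - 1) * (\<Sum>i<n. q ^ i) + 1" by (rule Suc)
  also have "(q - 1) * (\<Sum>i<n. q ^ i) + 1 + (q - 1) * ((q - 1) * (\<Sum>i<n. q ^ i) + 1)
      = (q - 1) * ((\<Sum>i<n. q ^ i) + q ^ n) + 1"
    by (simp only: Suc distrib_left add_ac mult_1_right)
  finally show ?case by simp
qed simp

text \<open>
The binomial theorem to first order: all later terms contain the factor \<open>r ^ 2\<close>.
\<close>

lemma power_one_plus_mult_cong: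
  fixes r t :: nat
  shows "[(1 + r * t) ^ i = 1 + i * (r * t)] (mod r ^ 2)"
proof (induction i)
  case (Suc i)
  have "[(1 + r * t) ^ Suc i = (1 + i * (r * t)) * (1 + r * t)] (mod r ^ 2)"
    using cong_mult[OF Suc cong_refl[of "1 + r * t"]] by (simp add: mult.commute)
  also have "(1 + i * (r * t)) * (1 + r * t) = 1 + Suc i * (r * t) + r ^ 2 * (i * t ^ 2)"
    by (simp add: algebra_simps power2_eq_square)
  also have "[\<dots> = 1 + Suc i * (r * t)] (mod r ^ 2)"
    by (simp add: cong_def)
  finally show ?case .
qed simp

text \<open>
For \<open>q = 1 + r t\<close> the sum is congruent to \<open>r + r t \<cdot> r (r - 1) / 2\<close> modulo \<open>r ^ 2\<close>. If \<open>r\<close>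
is odd, the second term vanishes and \<open>r\<close> remains. For \<open>r = 2\<close> the sum is \<open>1 + q\<close>, which is \<open>2\<close>
modulo \<open>4\<close> only because \<open>q\<close> is \<open>1\<close> modulo \<open>4\<close>; this is where the case of two is special.
\<close>

lemma square_not_dvd_geometric_sum:
  fixes q r :: nat
  assumes "Factorial_Ring.prime r" and "[q = 1] (mod r)" and "r = 2 \<Longrightarrow> [q = 1] (mod 4)"
  shows "\<not> r ^ 2 dvd (\<Sum>i<r. q ^ i)"
proof
  assume dvd: "r ^ 2 dvd (\<Sum>i<r. q ^ i)"
  have r2: "r \<ge> 2" using assms(1) by (rule prime_ge_2_nat)
  show False
  proof (cases "r = 2")
    case True
    then have "4 dvd 1 + q" using dvd by (simp add: lessThan_nat_numeral)
    then show False using assms(3) True by (simp add: cong_def) presburger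
  next
    case False
    then have odd: "odd r" using assms(1) r2 primes_dvd_imp_eq two_is_prime_nat by blast
    have "q mod r = 1" using assms(2) r2 by (simp add: cong_def)
    then have "q = 1 + r * (q div r)"
      using mult_div_mod_eq[of r q] by linarith
    then obtain t where q: "q = 1 + r * t" by blast
    have "[(\<Sum>i<r. q ^ i) = (\<Sum>i<r. 1 + i * (r * t))] (mod r ^ 2)"
      unfolding q by (intro cong_sum power_one_plus_mult_cong)
    moreover have "(\<Sum>i<r. 1 + i * (r * t)) = r + (\<Sum>i<r. i) * (r * t)"
      unfolding sum.distrib sum_distrib_right by simp
    moreover have "(\<Sum>i<r. i) = r * ((r - 1) div 2)"
      using odd Sum_Ico_nat[of 0 r] by (simp add: lessThan_atLeast0 div_mult_swap)
    ultimately have "[(\<Sum>i<r. q ^ i) = r + r ^ 2 * ((r - 1) div 2 * t)] (mod r ^ 2)"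
      by (simp add: power2_eq_square algebra_simps)
    then have "[(\<Sum>i<r. q ^ i) = r] (mod r ^ 2)"
      by (simp add: cong_def)
    then have "r ^ 2 dvd r"
      using dvd cong_dvd_iff cong_sym by (metis cong_dvd_iff)
    then show False
      using r2 by (auto dest!: dvd_imp_le simp: power2_eq_square)
  qed
qed

text \<open>
An instance of lifting the exponent. Modulo \<open>r\<close> the sum is \<open>k\<close>, so \<open>k = r k'\<close>,
and the sum splits as the geometric sum of \<open>p\<close> with \<open>k'\<close> terms times that of \<open>p ^ k'\<close> with \<open>r\<close>
terms. The second factor takes up at most one factor \<open>r\<close>, so the induction hypothesis applies
to \<open>k'\<close>.
\<close>

lemma prime_power_dvd_of_dvd_geometric_sum:
  fixes p r k n :: nat
  assumes r: "Factorial_Ring.prime r" and p: "[p = 1] (mod r)" "r = 2 \<Longrightarrow> [p = 1] (mod 4)"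
    and "r ^ n dvd (\<Sum>i<k. p ^ i)"
  shows "r ^ n dvd k"
  using assms(4)
proof (induction n arbitrary: k)
  case 0
  show ?case by simp
next
  case (Suc n)
  have "[(\<Sum>i<k. p ^ i) = (\<Sum>i<k. 1 ^ i)] (mod r)"
    by (intro cong_sum cong_pow p)
  moreover have "r dvd (\<Sum>i<k. p ^ i)"
    using Suc.prems by (simp add: dvd_mult_left)
  ultimately have "r dvd k"
    using cong_dvd_iff by fastforce
  then obtain k' where k: "k = r * k'" by blast
  define B where "B = (\<Sum>i<r. (p ^ k') ^ i)"
  have "[p ^ k' = 1 ^ k'] (mod r)" by (intro cong_pow p)
  moreover have "[p ^ k' = 1 ^ k'] (mod 4)" if "r = 2" by (intro cong_pow p that)
  ultimately have B: "\<not> r ^ 2 dvd B"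
    unfolding B_def by (intro square_not_dvd_geometric_sum r) simp_all
  have dvd: "r ^ Suc n dvd B * (\<Sum>i<k'. p ^ i)"
    using Suc.prems unfolding k B_def geometric_sum_mult by simp
  have "r ^ n dvd (\<Sum>i<k'. p ^ i)"
  proof (cases "r dvd B")
    case True
    then obtain b where b: "B = r * b" by blast
    have "\<not> r dvd b" using B b by (auto simp: power2_eq_square)
    then have "Rings.coprime (r ^ n) b"
      using r by (simp add: prime_imp_coprime)
    moreover have "r ^ n dvd b * (\<Sum>i<k'. p ^ i)"
      using dvd r by (simp add: b mult.assoc prime_gt_0_nat)
    ultimately show ?thesis by (simp add: coprime_dvd_mult_right_iff)
  next
    case False
    then have "Rings.coprime (r ^ Suc n) B"
      using r by (simp add: prime_imp_coprime)
    then have "r ^ Suc n dvd (\<Sum>i<k'. p ^ i)"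
      using dvd by (simp only: coprime_dvd_mult_right_iff)
    then show ?thesis by (simp add: dvd_mult_right)
  qed
  then have "r ^ n dvd k'" by (rule Suc.IH)
  then show ?case
    unfolding k power_Suc by (rule mult_dvd_mono[OF dvd_refl])
qed

section \<open>The search for an element that is not an r-th power\<close>

text \<open>
The multiplier is a unit modulo \<open>q\<close>, hence the shift permutes the residues. The index is taken
positive because the search never evaluates the shift at \<open>0\<close>.
\<close>

lemma standard_affine_shift_surj:
  assumes "Factorial_Ring.prime q" and "0 \<le> k" "k < q"
  shows "\<exists>i>0. standard_affine_shift q i = k"
proof -
  define P where "P = (\<lambda>m::int. real_of_int m \<le> 4 / 5 * real_of_int q \<and> gcd m q = 1)"
  define m where "m = (GREATEST m. P m)"
  define c where "c = \<lfloor>2 / 3 * real_of_int q\<rfloor>"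
  have q: "q \<ge> 2" using assms(1) by (rule prime_ge_2_int)
  have "P 1" using q by (simp add: P_def)
  have bound: "m \<le> q" if "P m" for m
    using that q unfolding P_def by linarith
  \<comment> \<open>The multiplier exists: \<open>1\<close> is a candidate as \<open>q \<ge> 2\<close>, and candidates are bounded.\<close>
  have "P m"
  proof -
    have fin: "finite {m. P m \<and> m \<ge> 1}"
      by (rule finite_subset[of _ "{1..q}"]) (auto dest: bound)
    define M where "M = Max {m. P m \<and> m \<ge> 1}"
    have "M \<in> {m. P m \<and> m \<ge> 1}"
      unfolding M_def using fin \<open>P 1\<close> by (intro Max_in) auto
    moreover have "y \<le> M" if "P y" for y
    proof (cases "y \<ge> 1")
      case True
      then show ?thesis using fin that unfolding M_def by simp
    next
      case False
      then show ?thesis using calculation by simp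
    qed
    ultimately have "m = M"
      unfolding m_def by (intro Greatest_equality) auto
    with \<open>M \<in> _\<close> show ?thesis by simp
  qed
  then have "Rings.coprime m q" by (simp add: P_def coprime_iff_gcd_eq_1[symmetric])
  then obtain u where u: "[m * u = 1] (mod q)"
    using cong_solve_coprime_int by blast
  \<comment> \<open>Solve \<open>m i + c = k\<close> modulo \<open>q\<close>; adding \<open>q\<close> makes the solution positive.\<close>
  define i where "i = (u * (k - c)) mod q + q"
  have "[m * i + c = m * (u * (k - c)) + c] (mod q)"
    unfolding i_def by (intro cong_add cong_mult) (auto simp: cong_def)
  also have "m * (u * (k - c)) + c = m * u * (k - c) + c" by simp
  also have "[m * u * (k - c) + c = 1 * (k - c) + c] (mod q)"
    by (intro cong_add cong_mult u cong_refl)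
  finally have "(m * i + c) mod q = k"
    using assms by (simp add: cong_def)
  moreover have "i > 0" using q by (simp add: i_def add_nonneg_pos)
  ultimately show ?thesis
    unfolding standard_affine_shift_def Let_def m_def P_def c_def by blast
qed

text \<open>
The polynomial \<open>X ^ ((p - 1) / r) - 1\<close> has fewer than \<open>p - 1\<close> roots.
\<close>

lemma ex_non_rth_power:
  fixes r :: nat
  assumes "r \<ge> 2" and "r dvd CARD('p::prime_card) - 1"
  shows "\<exists>x::'p mod_ring. x \<noteq> 0 \<and> x ^ ((CARD('p) - 1) div r) \<noteq> 1"
proof (rule ccontr)
  assume *: "\<not> ?thesis"
  have p: "CARD('p) \<ge> 2" using prime_card prime_ge_2_nat by blast
  define d where "d = (CARD('p) - 1) div r"
  have d: "0 < d" "d < CARD('p) - 1"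
    using assms p by (auto simp: d_def div_greater_zero_iff dvd_imp_le)
  define g :: "'p mod_ring poly" where "g = monom 1 d - 1"
  have "coeff g d = 1" using d by (simp add: g_def)
  then have g: "g \<noteq> 0" by auto
  have "degree g \<le> d"
    unfolding g_def by (intro degree_diff_le degree_monom_le) auto
  have "UNIV - {0} \<subseteq> {x. poly g x = 0}"
    using * by (auto simp: g_def d_def poly_monom)
  then have "card (UNIV - {0 :: 'p mod_ring}) \<le> card {x. poly g x = 0}"
    by (intro card_mono) auto
  also have "\<dots> \<le> degree g" using g by (rule card_poly_roots_bound)
  finally show False using \<open>degree g \<le> d\<close> d by (simp add: card_Diff_subset)
qed

text \<open>
Every residue class occurs among the candidates, in particular one that stops the search.
\<close>

lemma NonRthPower_correct:
  fixes r :: nat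
  assumes "r \<ge> 2" and "r dvd CARD('p::prime_card) - 1"
  shows "(NonRthPower r :: 'p mod_ring) \<noteq> 0"
    and "(NonRthPower r :: 'p mod_ring) ^ ((CARD('p) - 1) div r) \<noteq> 1"
proof -
  let ?bad = "\<lambda>x::'p mod_ring. x = 0 \<or> x ^ ((CARD('p) - 1) div r) = 1"
  let ?shift = "\<lambda>i. of_int (standard_affine_shift (int CARD('p)) i) :: 'p mod_ring"
  obtain x :: "'p mod_ring" where x: "\<not> ?bad x"
    using ex_non_rth_power[OF assms] by blast
  obtain k where "k < CARD('p)" "x = of_nat k"
    using surj_of_nat_mod_ring by blast
  moreover obtain N where N: "N > 0" "standard_affine_shift (int CARD('p)) N = int k"
    using standard_affine_shift_surj[of "int CARD('p)" "int k"] prime_card_int \<open>k < CARD('p)\<close> by auto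
  ultimately have good: "\<not> ?bad (?shift N)" using x by simp
  let ?loop = "while (\<lambda>(i, a). ?bad a) (\<lambda>(i, a). (i + 1, ?shift (i + 1))) (0 :: int, 0)"
  \<comment> \<open>The search stops at index \<open>N\<close> at the latest.\<close>
  have "\<not> ?bad (snd ?loop)"
  proof (rule while_rule[where P = "\<lambda>(i, a). i \<le> N \<and> (i = N \<longrightarrow> a = ?shift i)"
        and r = "measure (\<lambda>(i, a). nat (N - i))"])
    show "case (0, 0) of (i, a) \<Rightarrow> i \<le> N \<and> (i = N \<longrightarrow> a = ?shift i)"
      using N by simp
    fix s :: "int \<times> 'p mod_ring"
    assume inv: "case s of (i, a) \<Rightarrow> i \<le> N \<and> (i = N \<longrightarrow> a = ?shift i)"
    obtain i a where s: "s = (i, a)" by fastforce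
    show "\<not> ?bad (snd s)" if "\<not> (case s of (i, a) \<Rightarrow> ?bad a)" using that by (simp add: s)
    assume bad: "case s of (i, a) \<Rightarrow> ?bad a"
    have "i < N" using inv bad good by (cases "i = N") (auto simp: s)
    then show "case (case s of (i, a) \<Rightarrow> (i + 1, ?shift (i + 1))) of
        (i, a) \<Rightarrow> i \<le> N \<and> (i = N \<longrightarrow> a = ?shift i)"
      and "(case s of (i, a) \<Rightarrow> (i + 1, ?shift (i + 1)), s) \<in> measure (\<lambda>(i, a). nat (N - i))"
      by (auto simp: s)
  qed auto
  then have "\<not> ?bad (NonRthPower r)" unfolding NonRthPower_def .
  then show "(NonRthPower r :: 'p mod_ring) \<noteq> 0"
    and "(NonRthPower r :: 'p mod_ring) ^ ((CARD('p) - 1) div r) \<noteq> 1" by auto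
qed

section \<open>Conjugates of iterated roots\<close>

interpretation to_ac_hom: field_hom "to_ac :: 'a::field \<Rightarrow> 'a alg_closure"
  by unfold_locales simp_all

text \<open>
The Frobenius map fixes the coefficients of \<open>g\<close>, so it permutes the roots of \<open>g\<close>.
\<close>

lemma map_poly_to_ac_root_power:
  fixes g :: "'p::prime_card mod_ring poly"
  assumes "poly (map_poly to_ac g) x = 0"
  shows "poly (map_poly to_ac g) (x ^ CARD('p) ^ k) = 0"
proof (induction k)
  case (Suc k)
  let ?y = "x ^ CARD('p) ^ k"
  have char: "Factorial_Ring.prime CHAR('p mod_ring alg_closure)"
    "CARD('p) = CHAR('p mod_ring alg_closure)"
    using prime_card[where 'a = 'p] by simp_all
  have "0 = poly (map_poly to_ac g) ?y ^ CARD('p)"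
    using Suc prime_card[where 'a = 'p] by (simp add: prime_gt_0_nat)
  also have "\<dots> = (\<Sum>i\<le>Polynomial.degree g. (to_ac (coeff g i) * ?y ^ i) ^ CARD('p))"
    by (simp add: poly_altdef freshmans_dream_sum[OF char])
  also have "\<dots> = (\<Sum>i\<le>Polynomial.degree g. to_ac (coeff g i) * (?y ^ CARD('p)) ^ i)"
    by (intro sum.cong refl) (simp add: power_mult_distrib mult_ac flip: to_ac_power power_mult)
  also have "\<dots> = poly (map_poly to_ac g) (?y ^ CARD('p))"
    by (simp add: poly_altdef)
  finally show ?case by (simp add: mult.commute flip: power_mult)
qed (use assms in simp)

text \<open>
The order of \<open>z\<close> is exactly \<open>r ^ n\<close>. By Bezout, the power of \<open>z\<close> with exponent \<open>gcd (r ^ n) s = r ^ j\<close> is \<open>1\<close>, which forces \<open>j = n\<close>.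
\<close>

lemma dvd_exponent_of_exact_order:
  fixes z :: "'a::field"
  assumes r: "Factorial_Ring.prime r"
    and "z ^ (r ^ n) = 1" "n > 0 \<Longrightarrow> z ^ (r ^ (n - 1)) \<noteq> 1" "z ^ s = 1"
  shows "r ^ n dvd s"
proof -
  have "z \<noteq> 0" using assms(2) r by (auto simp: power_0_left prime_gt_0_nat split: if_splits)
  obtain j where j: "j \<le> n" "gcd (r ^ n) s = r ^ j"
    using divides_primepow_nat[OF r, of "gcd (r ^ n) s" n] by auto
  have "r ^ n \<noteq> 0" using r by (auto simp: prime_gt_0_nat)
  then obtain u v where uv: "r ^ n * u = s * v + gcd (r ^ n) s"
    using bezout_nat[of "r ^ n" s] by blast
  have "z ^ (r ^ n * u) = 1" by (simp add: power_mult assms(2))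
  moreover have "z ^ (s * v) = 1" by (simp add: power_mult assms(4))
  ultimately have *: "z ^ (r ^ j) = 1"
    using uv by (simp add: power_add j)
  have "j = n"
  proof (rule ccontr)
    assume "j \<noteq> n"
    with j have "n > 0" "n - 1 = j + (n - 1 - j)" by auto
    then have "z ^ (r ^ (n - 1)) = 1"
      using * by (metis power_add power_mult power_one)
    with assms(3) \<open>n > 0\<close> show False by simp
  qed
  then show ?thesis using j by (metis gcd_dvd2)
qed

text \<open>
A compatible system of iterated \<open>r\<close>-th roots of a non-\<open>r\<close>-th power \<open>a\<close>, inside an algebraic
closure. The condition on \<open>a ^ ((p - 1) / r)\<close> is Euler's criterion for not being an \<open>r\<close>-th power.
\<close>

locale root_tower =
  fixes r :: nat and a :: "'p::prime_card mod_ring" and \<alpha> :: "nat \<Rightarrow> 'p mod_ring alg_closure"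
  assumes prime_r: "Factorial_Ring.prime r"
    and r_dvd: "r dvd CARD('p) - 1"
    and four_dvd: "r = 2 \<Longrightarrow> 4 dvd CARD('p) - 1"
    and a_nz: "a \<noteq> 0"
    and a_nonpower: "a ^ ((CARD('p) - 1) div r) \<noteq> 1"
    and \<alpha>_0: "\<alpha> 0 = to_ac a"
    and \<alpha>_Suc: "\<alpha> (Suc n) ^ r = \<alpha> n"
begin

lemma \<alpha>_power: "j \<le> n \<Longrightarrow> \<alpha> n ^ (r ^ (n - j)) = \<alpha> j"
proof (induction "n - j" arbitrary: n)
  case (Suc d)
  then obtain m where n: "n = Suc m" by (cases n) auto
  with Suc.hyps(2) have "d = m - j" "j \<le> m" by auto
  then have "\<alpha> m ^ (r ^ d) = \<alpha> j" using Suc.hyps(1) by simp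
  then show ?case
    unfolding Suc.hyps(2)[symmetric] unfolding n power_Suc power_mult \<alpha>_Suc .
qed simp

lemma \<alpha>_nz: "\<alpha> n \<noteq> 0"
proof
  assume "\<alpha> n = 0"
  then have "\<alpha> 0 = 0"
    using \<alpha>_power[of 0 n] prime_r by (simp add: prime_gt_0_nat power_0_left)
  then show False using a_nz by (simp add: \<alpha>_0)
qed

text \<open>
The element \<open>\<zeta> = \<alpha> n ^ (p - 1)\<close> measures how Frobenius moves \<open>\<alpha> n\<close>. Its \<open>r ^ n\<close>-th power is
\<open>a ^ (p - 1) = 1\<close> and its \<open>r ^ (n - 1)\<close>-th power is \<open>a ^ ((p - 1) / r) \<noteq> 1\<close>, so it has order
\<open>r ^ n\<close>. Since \<open>\<alpha> n ^ (p ^ d) = \<alpha> n \<cdot> \<zeta> ^ (1 + p + \<dots> + p ^ (d - 1))\<close>, the claim becomes the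
divisibility statement on geometric sums.
\<close>

lemma frobenius_fixes_\<alpha>_imp_dvd:
  assumes "\<alpha> n ^ (CARD('p) ^ d) = \<alpha> n"
  shows "r ^ n dvd d"
proof -
  have p1: "CARD('p) > 1" using prime_card prime_gt_1_nat by blast
  define z where "z = \<alpha> n ^ (CARD('p) - 1)"
  have z_pow: "z ^ (r ^ (n - j)) = \<alpha> j ^ (CARD('p) - 1)" if "j \<le> n" for j
  proof -
    have "z ^ (r ^ (n - j)) = (\<alpha> n ^ (r ^ (n - j))) ^ (CARD('p) - 1)"
      unfolding z_def by (simp add: mult.commute flip: power_mult)
    then show ?thesis unfolding \<alpha>_power[OF that] .
  qed
  have fermat: "x ^ (CARD('p) - 1) = 1" if "x \<noteq> 0" for x :: "'p mod_ring"
  proof -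
    have "x * x ^ (CARD('p) - 1) = x ^ CARD('p)"
      using p1 by (simp flip: power_Suc)
    then show ?thesis using that by simp
  qed
  have 1: "z ^ (r ^ n) = 1"
    using z_pow[of 0] fermat[OF a_nz] by (simp add: \<alpha>_0 flip: to_ac_power)
  have 2: "z ^ (r ^ (n - 1)) \<noteq> 1" if "n > 0"
  proof -
    obtain k where k: "CARD('p) - 1 = r * k" using r_dvd by blast
    have "z ^ (r ^ (n - 1)) = (\<alpha> 1 ^ r) ^ k"
      using z_pow[of 1] that unfolding k power_mult by simp
    also have "\<dots> = to_ac (a ^ k)" using \<alpha>_Suc[of 0] by (simp add: \<alpha>_0)
    finally have "z ^ (r ^ (n - 1)) = to_ac (a ^ k)" .
    moreover have "to_ac (a ^ k) \<noteq> to_ac 1"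
      using a_nonpower prime_gt_0_nat[OF prime_r] unfolding k to_ac_eq_iff by simp
    ultimately show ?thesis by simp
  qed
  have "CARD('p) ^ d - 1 = (CARD('p) - 1) * (\<Sum>i<d. CARD('p) ^ i)"
    using power_eq_geometric_sum[of "CARD('p)" d] p1 by simp
  then have "z ^ (\<Sum>i<d. CARD('p) ^ i) = \<alpha> n ^ (CARD('p) ^ d - 1)"
    by (simp add: z_def flip: power_mult)
  also have "\<dots> = 1"
  proof -
    have "\<alpha> n * \<alpha> n ^ (CARD('p) ^ d - 1) = \<alpha> n ^ (CARD('p) ^ d)"
      using p1 by (simp flip: power_Suc)
    then show ?thesis using \<alpha>_nz assms by simp
  qed
  finally have "r ^ n dvd (\<Sum>i<d. CARD('p) ^ i)"
    using dvd_exponent_of_exact_order[OF prime_r 1] 2 by blast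
  then show ?thesis
  proof (rule prime_power_dvd_of_dvd_geometric_sum[OF prime_r, rotated 2])
    show "[CARD('p) = 1] (mod r)"
      using r_dvd p1 by (simp add: cong_altdef_nat)
    show "[CARD('p) = 1] (mod 4)" if "r = 2"
      using four_dvd[OF that] p1 by (simp add: cong_altdef_nat)
  qed
qed

lemma conjugates_inj: "inj_on (\<lambda>k. \<alpha> n ^ (CARD('p) ^ k)) {..<r ^ n}"
proof (rule linorder_inj_onI')
  fix i j assume ij: "i \<in> {..<r ^ n}" "j \<in> {..<r ^ n}" "i < j"
  show "\<alpha> n ^ (CARD('p) ^ i) \<noteq> \<alpha> n ^ (CARD('p) ^ j)"
  proof
    assume eq: "\<alpha> n ^ (CARD('p) ^ i) = \<alpha> n ^ (CARD('p) ^ j)"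
    let ?x = "\<alpha> n ^ (CARD('p) ^ (j - i)) - \<alpha> n"
    have char: "Factorial_Ring.prime CHAR('p mod_ring alg_closure)"
      "CARD('p) ^ i = CHAR('p mod_ring alg_closure) ^ i"
      using prime_card[where 'a = 'p] by simp_all
    have "?x ^ (CARD('p) ^ i) + \<alpha> n ^ (CARD('p) ^ i) = (\<alpha> n ^ (CARD('p) ^ (j - i))) ^ (CARD('p) ^ i)"
      using freshmans_dream'[OF char, of ?x "\<alpha> n"] by simp
    also have "\<dots> = \<alpha> n ^ (CARD('p) ^ j)"
      using ij by (simp flip: power_mult power_add)
    finally have "?x = 0" using eq by simp
    then have "r ^ n dvd j - i" by (intro frobenius_fixes_\<alpha>_imp_dvd) simp
    then show False using ij by (auto dest!: dvd_imp_le)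
  qed
qed

text \<open>
This is the irreducibility of \<open>X ^ (r ^ n) - a\<close> in disguise: \<open>g\<close> vanishes at the \<open>r ^ n\<close> distinct
conjugates of \<open>\<alpha> n\<close>.
\<close>

lemma no_small_relation:
  assumes "poly (map_poly to_ac g) (\<alpha> n) = 0" and "Polynomial.degree g < r ^ n"
  shows "g = 0"
proof (rule ccontr)
  assume "g \<noteq> 0"
  then have nz: "map_poly to_ac g \<noteq> 0" by simp
  have "(\<lambda>k. \<alpha> n ^ (CARD('p) ^ k)) ` {..<r ^ n} \<subseteq> {x. poly (map_poly to_ac g) x = 0}"
    using map_poly_to_ac_root_power[OF assms(1)] by auto
  then have "card ((\<lambda>k. \<alpha> n ^ (CARD('p) ^ k)) ` {..<r ^ n}) \<le> card {x. poly (map_poly to_ac g) x = 0}"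
    by (intro card_mono poly_roots_finite[OF nz])
  also have "\<dots> \<le> Polynomial.degree (map_poly to_ac g)" using nz by (rule card_poly_roots_bound)
  finally show False
    using assms(2) by (simp add: card_image[OF conjugates_inj])
qed

end

section \<open>Polynomials in finitely many indeterminates and their evaluation\<close>

abbreviation mpolys :: "nat \<Rightarrow> 'a::comm_ring_1 mpoly set"
  where "mpolys n \<equiv> carrier (mpoly_ring n)"

lemma mpoly_ring_simps [simp]:
  "f \<otimes>\<^bsub>mpoly_ring n\<^esub> g = f * g" "f \<oplus>\<^bsub>mpoly_ring n\<^esub> g = f + g"
  "\<one>\<^bsub>mpoly_ring n\<^esub> = 1" "\<zero>\<^bsub>mpoly_ring n\<^esub> = 0"
  by (simp_all add: mpoly_ring_def ring_of_type_algebra_def)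

lemma mem_mpolys_iff:
  "f \<in> mpolys n \<longleftrightarrow> (\<forall>m\<in>Poly_Mapping.keys f. Poly_Mapping.keys m \<subseteq> {1..n})"
  by (simp add: mpoly_ring_def)

lemma mpolys_closed [intro, simp]:
  fixes f g :: "'a::comm_ring_1 mpoly"
  shows "0 \<in> mpolys n" "1 \<in> mpolys n" "Const c \<in> mpolys n"
    and "f \<in> mpolys n \<Longrightarrow> g \<in> mpolys n \<Longrightarrow> f + g \<in> mpolys n"
    and "f \<in> mpolys n \<Longrightarrow> g \<in> mpolys n \<Longrightarrow> f * g \<in> mpolys n"
    and "f \<in> mpolys n \<Longrightarrow> - f \<in> mpolys n"
proof -
  show "0 \<in> mpolys n" "1 \<in> mpolys n" "Const c \<in> mpolys n"
    by (auto simp: mem_mpolys_iff Const_def)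
  show "f \<in> mpolys n \<Longrightarrow> g \<in> mpolys n \<Longrightarrow> f + g \<in> mpolys n"
    using Poly_Mapping.keys_add[of f g] by (fastforce simp: mem_mpolys_iff)
  show "f \<in> mpolys n \<Longrightarrow> - f \<in> mpolys n"
    by (simp add: mem_mpolys_iff)
  assume fg: "f \<in> mpolys n" "g \<in> mpolys n"
  show "f * g \<in> mpolys n"
    unfolding mem_mpolys_iff
  proof
    fix m assume "m \<in> Poly_Mapping.keys (f * g)"
    then obtain u v where "m = u + v" "u \<in> Poly_Mapping.keys f" "v \<in> Poly_Mapping.keys g"
      using keys_mult[of f g] by blast
    then show "Poly_Mapping.keys m \<subseteq> {1..n}"
      using fg Poly_Mapping.keys_add[of u v] by (fastforce simp: mem_mpolys_iff)
  qed
qed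

lemma mpolys_diff [intro, simp]:
  fixes f g :: "'a::comm_ring_1 mpoly"
  shows "f \<in> mpolys n \<Longrightarrow> g \<in> mpolys n \<Longrightarrow> f - g \<in> mpolys n"
  using mpolys_closed(4)[of f n "- g"] by simp

lemma mpolys_power [intro, simp]:
  fixes f :: "'a::comm_ring_1 mpoly"
  shows "f \<in> mpolys n \<Longrightarrow> f ^ k \<in> mpolys n"
  by (induction k) auto

lemma mpolys_sum [intro, simp]:
  fixes f :: "'i \<Rightarrow> 'a::comm_ring_1 mpoly"
  shows "(\<And>i. i \<in> A \<Longrightarrow> f i \<in> mpolys n) \<Longrightarrow> sum f A \<in> mpolys n"
  by (induction A rule: infinite_finite_induct) auto

lemma Var_in_mpolys [simp]:
  "(Var j :: 'a::comm_ring_1 mpoly) \<in> mpolys n \<longleftrightarrow> j \<in> {1..n}"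
  by (auto simp: mem_mpolys_iff Var_def)

lemma mpolys_mono: "n \<le> n' \<Longrightarrow> mpolys n \<subseteq> mpolys n'"
  by (fastforce simp: mem_mpolys_iff)

lemma cring_mpoly_ring: "cring (mpoly_ring n :: 'a::comm_ring_1 mpoly ring)"
proof (rule cringI)
  show "abelian_group (mpoly_ring n :: 'a mpoly ring)"
  proof (rule abelian_groupI)
    fix f :: "'a mpoly" assume "f \<in> mpolys n"
    then show "\<exists>g\<in>mpolys n. g \<oplus>\<^bsub>mpoly_ring n\<^esub> f = \<zero>\<^bsub>mpoly_ring n\<^esub>"
      by (intro bexI[of _ "- f"]) auto
  qed (auto simp: add_ac)
  show "Group.comm_monoid (mpoly_ring n :: 'a mpoly ring)"
    by unfold_locales (auto simp: mult_ac)
qed (auto simp: distrib_right)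

lemma a_minus_mpoly_ring [simp]:
  assumes "f \<in> mpolys n" "g \<in> mpolys n"
  shows "f \<ominus>\<^bsub>mpoly_ring n\<^esub> g = f - g"
proof -
  interpret cring "mpoly_ring n :: 'a mpoly ring" by (rule cring_mpoly_ring)
  have "\<ominus>\<^bsub>mpoly_ring n\<^esub> g = - g"
    using assms by (intro minus_equality) auto
  then show ?thesis by (simp add: a_minus_def)
qed

lemma mpoly_single_add_induct [case_names zero add_single]:
  fixes f :: "'k \<Rightarrow>\<^sub>0 'b::comm_monoid_add"
  assumes "P 0"
    and "\<And>f k b. k \<notin> Poly_Mapping.keys f \<Longrightarrow> b \<noteq> 0 \<Longrightarrow> P f \<Longrightarrow> P (f + Poly_Mapping.single k b)"
  shows "P f"
proof (induction f rule: update_induct)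
  case (update f k b)
  have "Poly_Mapping.update k b f = f + Poly_Mapping.single k b"
    using update(1) by (intro poly_mapping_eqI)
      (auto simp: lookup_update lookup_add lookup_single when_def in_keys_iff)
  then show ?case using assms(2) update by metis
qed (rule assms(1))

lemma keys_add_nat:
  "Poly_Mapping.keys (m + m') = Poly_Mapping.keys m \<union> Poly_Mapping.keys (m' :: nat \<Rightarrow>\<^sub>0 nat)"
  by (auto simp: in_keys_iff lookup_add)

lemma Var_power: "Var j ^ e = (Poly_Mapping.single (Poly_Mapping.single j e) 1 :: 'a::comm_ring_1 mpoly)"
proof (induction e)
  case (Suc e)
  have "Var j ^ Suc e = Poly_Mapping.single (Poly_Mapping.single j 1 + Poly_Mapping.single j e) (1 * 1 :: 'a)"
    unfolding power_Suc Suc by (simp add: Var_def mult_single)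
  then show ?case by (simp flip: single_add)
qed simp

text \<open>
Structural induction on \<open>F[X\<^sub>1, \<dots>, X\<^sub>n]\<close> as the algebra generated by its indeterminates, which
hides the representation by finitely supported maps.
\<close>

lemma mpolys_induct [consumes 1, case_names Const add mult_Var]:
  fixes f :: "'a::comm_ring_1 mpoly"
  assumes f: "f \<in> mpolys n"
    and Const: "\<And>c. P (Const c)"
    and add: "\<And>f g. f \<in> mpolys n \<Longrightarrow> g \<in> mpolys n \<Longrightarrow> P f \<Longrightarrow> P g \<Longrightarrow> P (f + g)"
    and mult_Var: "\<And>f j. f \<in> mpolys n \<Longrightarrow> P f \<Longrightarrow> j \<in> {1..n} \<Longrightarrow> P (f * Var j)"
  shows "P f"
proof -
  have monomial: "P (Poly_Mapping.single m c)" if "Poly_Mapping.keys m \<subseteq> {1..n}" for m c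
    using that
  proof (induction m rule: mpoly_single_add_induct)
    case zero
    show ?case using Const by (simp add: Const_def)
  next
    case (add_single m j e)
    then have j: "j \<in> {1..n}" and m: "Poly_Mapping.keys m \<subseteq> {1..n}"
      by (auto simp: keys_add_nat)
    have "P (Poly_Mapping.single m c * Var j ^ i)" for i
    proof (induction i)
      case 0
      show ?case using add_single.IH[OF m] by simp
    next
      case (Suc i)
      have "Poly_Mapping.single m c * Var j ^ i \<in> mpolys n"
        using j m
        by (intro mpolys_closed(5) mpolys_power) (auto simp: mem_mpolys_iff[of "Poly_Mapping.single m c"])
      from mult_Var[OF this Suc j] show ?case by (simp add: mult_ac)
    qed
    from this[of e] show ?case by (simp add: Var_power mult_single)
  qed
  show ?thesis
    using f
  proof (induction f rule: mpoly_single_add_induct)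
    case zero
    show ?case using Const[of 0] by (simp add: Const_def)
  next
    case (add_single f m c)
    have "Poly_Mapping.keys (f + Poly_Mapping.single m c) = insert m (Poly_Mapping.keys f)"
      using add_single.hyps
      by (auto simp: in_keys_iff lookup_add lookup_single when_def split: if_splits)
    then have "f \<in> mpolys n" "Poly_Mapping.keys m \<subseteq> {1..n}"
      using add_single.prems by (auto simp: mem_mpolys_iff)
    moreover from this have "Poly_Mapping.single m c \<in> mpolys n"
      by (auto simp: mem_mpolys_iff)
    ultimately show ?case using add add_single.IH monomial by blast
  qed
qed

definition eval_monom :: "(nat \<Rightarrow> 'b::comm_semiring_1) \<Rightarrow> (nat \<Rightarrow>\<^sub>0 nat) \<Rightarrow> 'b"
  where "eval_monom v m = (\<Prod>j\<in>Poly_Mapping.keys m. v j ^ Poly_Mapping.lookup m j)"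

definition eval_mpoly :: "('a::comm_ring_1 \<Rightarrow> 'b::comm_ring_1) \<Rightarrow> (nat \<Rightarrow> 'b) \<Rightarrow> 'a mpoly \<Rightarrow> 'b"
  where "eval_mpoly h v f =
    (\<Sum>m\<in>Poly_Mapping.keys f. h (Poly_Mapping.lookup f m) * eval_monom v m)"

lemma eval_monom_add: "eval_monom v (m + m') = eval_monom v m * eval_monom v m'"
proof -
  let ?K = "Poly_Mapping.keys m \<union> Poly_Mapping.keys m'"
  have sup: "eval_monom v n = (\<Prod>j\<in>?K. v j ^ Poly_Mapping.lookup n j)"
    if "Poly_Mapping.keys n \<subseteq> ?K" for n
    unfolding eval_monom_def using that by (intro prod.mono_neutral_left) (auto simp: in_keys_iff)
  show ?thesis
    by (subst (1 2 3) sup) (auto simp: keys_add_nat lookup_add power_add prod.distrib)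
qed

context comm_ring_hom
begin

lemma eval_mpoly_superset:
  assumes "finite K" "Poly_Mapping.keys f \<subseteq> K"
  shows "eval_mpoly hom v f = (\<Sum>m\<in>K. hom (Poly_Mapping.lookup f m) * eval_monom v m)"
  unfolding eval_mpoly_def using assms by (intro sum.mono_neutral_left) (auto simp: in_keys_iff)

lemma eval_mpoly_add: "eval_mpoly hom v (f + g) = eval_mpoly hom v f + eval_mpoly hom v g"
proof -
  let ?K = "Poly_Mapping.keys f \<union> Poly_Mapping.keys g"
  have "eval_mpoly hom v n = (\<Sum>m\<in>?K. hom (Poly_Mapping.lookup n m) * eval_monom v m)"
    if "n \<in> {f, g, f + g}" for n
    using that Poly_Mapping.keys_add[of f g] by (intro eval_mpoly_superset) auto
  then show ?thesis
    by (simp add: lookup_add hom_add distrib_right sum.distrib)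
qed

lemma eval_mpoly_single: "eval_mpoly hom v (Poly_Mapping.single m c) = hom c * eval_monom v m"
  by (simp add: eval_mpoly_def)

lemma eval_mpoly_mult: "eval_mpoly hom v (f * g) = eval_mpoly hom v f * eval_mpoly hom v g"
proof (induction f rule: mpoly_single_add_induct)
  case zero
  show ?case by (simp add: eval_mpoly_def)
next
  case (add_single f m c)
  have "eval_mpoly hom v (Poly_Mapping.single m c * g) = hom c * eval_monom v m * eval_mpoly hom v g"
    by (induction g rule: mpoly_single_add_induct)
      (simp_all add: eval_mpoly_def[of _ _ 0] eval_mpoly_add eval_mpoly_single distrib_left
        mult_single hom_mult eval_monom_add mult_ac)
  with add_single show ?case
    by (simp add: distrib_right eval_mpoly_add eval_mpoly_single)
qed

lemma eval_mpoly_Const [simp]: "eval_mpoly hom v (Const c) = hom c"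
  by (simp add: Const_def eval_mpoly_single eval_monom_def)

lemma eval_mpoly_Var [simp]: "eval_mpoly hom v (Var j) = v j"
  by (simp add: Var_def eval_mpoly_single eval_monom_def)

lemma comm_ring_hom_eval_mpoly: "comm_ring_hom (eval_mpoly hom v)"
  by unfold_locales
    (use eval_mpoly_Const[of v 1] in \<open>simp_all add: eval_mpoly_add eval_mpoly_mult Const_def
      eval_mpoly_def[of _ _ 0]\<close>)

end

lemma Const_simps:
  "Const 0 = 0" "Const 1 = 1" "Const (x + y) = Const x + Const y"
  "Const (x * y :: 'a::comm_ring_1) = Const x * Const y"
  by (simp_all add: Const_def single_add mult_single)

interpretation Const_hom: comm_ring_hom "Const :: 'a::comm_ring_1 \<Rightarrow> 'a mpoly"
  by unfold_locales (simp_all add: Const_simps)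

lemma monic_in_Var_power_diff:
  fixes b :: "'a::comm_ring_1 mpoly"
  assumes "d > 0" and b: "\<And>m. m \<in> Poly_Mapping.keys b \<Longrightarrow> Poly_Mapping.lookup m i = 0"
  shows "monic_in i (Var i ^ d - b)"
proof -
  let ?f = "Var i ^ d - b" and ?m = "Poly_Mapping.single i d"
  have m_notin: "?m \<notin> Poly_Mapping.keys b" using b[of ?m] \<open>d > 0\<close> by auto
  have lookup: "Poly_Mapping.lookup ?f m = (1 when m = ?m) - Poly_Mapping.lookup b m" for m
    by (simp add: Var_power lookup_minus lookup_single eq_commute)
  have m_in: "?m \<in> Poly_Mapping.keys ?f" 
    using m_notin by (simp add: in_keys_iff lookup)
  have keys: "Poly_Mapping.keys ?f \<subseteq> insert ?m (Poly_Mapping.keys b)"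
    by (auto simp: in_keys_iff lookup when_def split: if_splits)
  have deg: "deg_in i ?f = d"
    unfolding deg_in_def
  proof (rule Max_eqI)
    show "d \<in> insert 0 ((\<lambda>m. Poly_Mapping.lookup m i) ` Poly_Mapping.keys ?f)"
      using m_in by (auto intro!: image_eqI[of _ _ ?m])
  qed (use keys b in auto)
  have "{m \<in> Poly_Mapping.keys ?f. Poly_Mapping.lookup m i = d} = {?m}"
    using m_in keys b \<open>d > 0\<close> by auto
  then show ?thesis
    using m_notin by (simp add: monic_in_def deg coeff_in_def lookup in_keys_iff)
qed

section \<open>The ideals of the tower as kernels of evaluation maps\<close>

lemma mpoly_idealI:
  fixes I :: "'a::comm_ring_1 mpoly set"
  assumes "I \<subseteq> mpolys n" "0 \<in> I"
    and "\<And>x y. x \<in> I \<Longrightarrow> y \<in> I \<Longrightarrow> x + y \<in> I"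
    and "\<And>g x. g \<in> mpolys n \<Longrightarrow> x \<in> I \<Longrightarrow> g * x \<in> I"
  shows "ideal I (mpoly_ring n)"
proof -
  interpret cring "mpoly_ring n :: 'a mpoly ring" by (rule cring_mpoly_ring)
  have neg: "- x \<in> I" if "x \<in> I" for x
    using assms(4)[of "- 1" x] that by simp
  have right: "x * g \<in> I" if "g \<in> mpolys n" "x \<in> I" for g x
    using assms(4)[OF that] by (simp add: mult.commute)
  show ?thesis
  proof (rule idealI)
    show "subgroup I (add_monoid (mpoly_ring n))"
    proof (rule add.subgroupI)
      fix x assume "x \<in> I"
      moreover have "\<ominus>\<^bsub>mpoly_ring n\<^esub> x = - x"
        using \<open>x \<in> I\<close> assms(1) by (intro minus_equality) auto
      ultimately show "\<ominus>\<^bsub>mpoly_ring n\<^esub> x \<in> I"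
        using neg by simp
    qed (use assms in auto)
  qed (use assms right ring_axioms in auto)
qed

lemma ideal_kernel:
  fixes h :: "'a::comm_ring_1 mpoly \<Rightarrow> 'b::comm_ring_1"
  assumes "comm_ring_hom h"
  shows "ideal {f \<in> mpolys n. h f = 0} (mpoly_ring n)"
proof -
  interpret comm_ring_hom h by fact
  show ?thesis by (rule mpoly_idealI) (auto simp: hom_add hom_mult)
qed

context
  fixes f :: "nat \<Rightarrow> 'a::comm_ring_1 mpoly" and n k :: nat
  assumes gens: "f ` {1..k} \<subseteq> mpolys n"
begin

lemma tower_ideal_is_ideal: "ideal (tower_ideal f n k) (mpoly_ring n)"
  unfolding tower_ideal_def
  by (intro ring.genideal_ideal cring.axioms(1) cring_mpoly_ring gens)

lemma tower_ideal_gens: "j \<in> {1..k} \<Longrightarrow> f j \<in> tower_ideal f n k"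
  unfolding tower_ideal_def
  using ring.genideal_self[OF cring.axioms(1)[OF cring_mpoly_ring] gens] by blast

lemma tower_ideal_minimal:
  assumes "ideal I (mpoly_ring n)" "f ` {1..k} \<subseteq> I"
  shows "tower_ideal f n k \<subseteq> I"
  unfolding tower_ideal_def
  by (intro ring.genideal_minimal cring.axioms(1) cring_mpoly_ring assms)

lemma tower_ideal_mem: "x \<in> tower_ideal f n k \<Longrightarrow> x \<in> mpolys n"
  using ideal.Icarr[OF tower_ideal_is_ideal] .

lemma tower_ideal_zero: "0 \<in> tower_ideal f n k"
  using additive_subgroup.zero_closed[OF ideal.axioms(1)[OF tower_ideal_is_ideal]] by simp

lemma tower_ideal_add:
  "x \<in> tower_ideal f n k \<Longrightarrow> y \<in> tower_ideal f n k \<Longrightarrow> x + y \<in> tower_ideal f n k"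
  using additive_subgroup.a_closed[OF ideal.axioms(1)[OF tower_ideal_is_ideal]] by fastforce

lemma tower_ideal_mult:
  "g \<in> mpolys n \<Longrightarrow> x \<in> tower_ideal f n k \<Longrightarrow> g * x \<in> tower_ideal f n k"
  using ideal.I_l_closed[OF tower_ideal_is_ideal] by fastforce

lemma tower_ideal_mult_right:
  "x \<in> tower_ideal f n k \<Longrightarrow> g \<in> mpolys n \<Longrightarrow> x * g \<in> tower_ideal f n k"
  using tower_ideal_mult by (simp add: mult.commute)

lemma tower_ideal_sum:
  "(\<And>i. i \<in> A \<Longrightarrow> x i \<in> tower_ideal f n k) \<Longrightarrow> sum x A \<in> tower_ideal f n k"
  by (induction A rule: infinite_finite_induct) (auto intro: tower_ideal_zero tower_ideal_add)

lemma tower_ideal_power_diff: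
  assumes "x - y \<in> tower_ideal f n k" "x \<in> mpolys n" "y \<in> mpolys n"
  shows "x ^ e - y ^ e \<in> tower_ideal f n k"
proof (induction e)
  case 0
  show ?case by (simp add: tower_ideal_zero)
next
  case (Suc e)
  have "x ^ Suc e - y ^ Suc e = x * (x ^ e - y ^ e) + (x - y) * y ^ e"
    by (simp add: algebra_simps)
  then show ?case
    using Suc assms by (auto intro: tower_ideal_add tower_ideal_mult tower_ideal_mult_right)
qed

end

lemma tower_ideal_mono:
  assumes "f ` {1..k'} \<subseteq> mpolys n'" "f ` {1..k} \<subseteq> mpolys n" "n \<le> n'" "k \<le> k'"
  shows "tower_ideal f n k \<subseteq> tower_ideal f n' k'"
proof -
  have "ideal (tower_ideal f n' k' \<inter> mpolys n) (mpoly_ring n)"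
    using mpolys_mono[OF assms(3)]
    by (intro mpoly_idealI)
      (auto intro: tower_ideal_zero[OF assms(1)] tower_ideal_add[OF assms(1)] tower_ideal_mult[OF assms(1)])
  then have "tower_ideal f n k \<subseteq> tower_ideal f n' k' \<inter> mpolys n"
    using assms tower_ideal_gens[OF assms(1)] by (intro tower_ideal_minimal) fastforce+
  then show ?thesis by blast
qed

text \<open>
The identification \<open>F[X\<^sub>1, \<dots>, X\<^sub>n] = F[X\<^sub>1, \<dots>, X\<^bsub>n-1\<^esub>][X\<^sub>n]\<close>.
\<close>

lemma ex_poly_in_last_Var:
  assumes "h \<in> mpolys n" and "n > 0"
  shows "\<exists>G :: 'a::comm_ring_1 mpoly poly. (\<forall>k. coeff G k \<in> mpolys (n - 1)) \<and> h = poly G (Var n)"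
  using assms(1)
proof (induction h rule: mpolys_induct)
  case (Const c)
  show ?case by (rule exI[of _ "[:Const c:]"]) (auto simp: coeff_pCons split: nat.split)
next
  case (add h h')
  then obtain G G' :: "'a mpoly poly" where "\<forall>k. coeff G k \<in> mpolys (n - 1)" "h = poly G (Var n)"
    "\<forall>k. coeff G' k \<in> mpolys (n - 1)" "h' = poly G' (Var n)" by blast
  then show ?case by (intro exI[of _ "G + G'"]) auto
next
  case (mult_Var h j)
  then obtain G :: "'a mpoly poly" where G: "\<forall>k. coeff G k \<in> mpolys (n - 1)" "h = poly G (Var n)"
    by blast
  show ?case
  proof (cases "j = n")
    case True
    with G show ?thesis
      by (intro exI[of _ "pCons 0 G"]) (auto simp: coeff_pCons mult.commute split: nat.split)
  next
    case False
    moreover have "1 \<le> j" "j \<le> n" using mult_Var.hyps by auto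
    ultimately have "1 \<le> j \<and> j \<le> n - 1" by linarith
    then have "(Var j :: 'a mpoly) \<in> mpolys (n - 1)" by simp
    with G show ?thesis
      by (intro exI[of _ "smult (Var j) G"]) (auto simp: mult.commute)
  qed
qed

interpretation Const_poly_hom: map_poly_comm_ring_hom "Const :: 'a::comm_ring_1 \<Rightarrow> 'a mpoly" ..

interpretation to_ac_poly_hom: map_poly_comm_ring_hom "to_ac :: 'a::field \<Rightarrow> 'a alg_closure" ..

lemma (in comm_ring_hom) eval_mpoly_poly_Const:
  "eval_mpoly hom v (poly (map_poly Const g) x) = poly (map_poly hom g) (eval_mpoly hom v x)"
proof (induction g)
  case 0
  show ?case by (simp add: eval_mpoly_def)
next
  case (pCons c g)
  then show ?case
    by (simp add: hom_distribs Const_hom.map_poly_pCons_hom eval_mpoly_add eval_mpoly_mult)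
qed

lemma finite_polys_degree_less: "finite {g :: 'a::{finite,zero} poly. Polynomial.degree g < N}"
proof (rule finite_subset)
  show "{g :: 'a poly. Polynomial.degree g < N} \<subseteq> Poly ` {xs. set xs \<subseteq> UNIV \<and> length xs \<le> N}"
  proof
    fix g :: "'a poly" assume "g \<in> {g. Polynomial.degree g < N}"
    then have "length (coeffs g) \<le> N" by (cases "g = 0") (auto simp: length_coeffs_degree)
    then show "g \<in> Poly ` {xs. set xs \<subseteq> UNIV \<and> length xs \<le> N}"
      by (intro image_eqI[of _ _ "coeffs g"]) auto
  qed
qed (intro finite_imageI finite_lists_length_le finite)

locale mpoly_tower = root_tower r a \<alpha>
  for r and a :: "'p::prime_card mod_ring" and \<alpha> +
  fixes f :: "nat \<Rightarrow> 'p mod_ring mpoly"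
  assumes f_1: "f 1 = Var 1 ^ r - Const a"
    and f_ge_2: "i \<ge> 2 \<Longrightarrow> f i = Var i ^ r - Var (i - 1)"
begin

text \<open>
With \<open>a\<close> in the role of a zeroth indeterminate, all \<open>f\<^sub>i\<close> have the form \<open>X\<^sub>i\<^sup>r - X\<^bsub>i-1\<^esub>\<close>.
\<close>

definition gen :: "nat \<Rightarrow> 'p mod_ring mpoly"
  where "gen i = (if i = 0 then Const a else Var i)"

abbreviation ev :: "'p mod_ring mpoly \<Rightarrow> 'p mod_ring alg_closure"
  where "ev \<equiv> eval_mpoly to_ac \<alpha>"

abbreviation I :: "nat \<Rightarrow> nat \<Rightarrow> 'p mod_ring mpoly set"
  where "I \<equiv> tower_ideal f"

interpretation ev: comm_ring_hom ev
  by (rule to_ac_hom.comm_ring_hom_eval_mpoly)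

lemma f_eq: "i > 0 \<Longrightarrow> f i = Var i ^ r - gen (i - 1)"
  using f_1 f_ge_2[of i] by (cases "i = 1") (auto simp: gen_def)

lemma gen_in_mpolys: "i \<le> n \<Longrightarrow> gen i \<in> mpolys n"
  by (auto simp: gen_def)

lemma f_in_mpolys: "i > 0 \<Longrightarrow> i \<le> n \<Longrightarrow> f i \<in> mpolys n"
  by (auto simp: f_eq intro!: mpolys_diff mpolys_power gen_in_mpolys)

lemma gens_in_mpolys: "k \<le> n \<Longrightarrow> f ` {1..k} \<subseteq> mpolys n"
  by (auto intro: f_in_mpolys)

lemma ev_gen [simp]: "ev (gen i) = \<alpha> i"
  by (simp add: gen_def \<alpha>_0)

lemma ev_f: "i > 0 \<Longrightarrow> ev (f i) = 0"
  using \<alpha>_Suc[of "i - 1"] by (simp add: f_eq ev.hom_minus ev.hom_power)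

lemma ev_tower_ideal:
  assumes "k \<le> n" "x \<in> I n k"
  shows "ev x = 0"
proof -
  have "I n k \<subseteq> {h \<in> mpolys n. ev h = 0}"
    using assms(1) f_in_mpolys ev_f
    by (intro tower_ideal_minimal gens_in_mpolys ideal_kernel ev.comm_ring_hom_axioms) auto
  with assms(2) show ?thesis by blast
qed

text \<open>
Climbing the tower one step at a time shows that the class of \<open>X\<^sub>n\<close> generates \<open>F\<^sub>n\<close> as an algebra.
\<close>

lemma gen_power_mem: "j \<le> n \<Longrightarrow> gen n ^ (r ^ (n - j)) - gen j \<in> I n n"
proof (induction "n - j" arbitrary: n)
  case 0
  then show ?case by (simp add: tower_ideal_zero[OF gens_in_mpolys])
next
  case (Suc d)
  then obtain m where n: "n = Suc m" by (cases n) auto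
  with Suc have d: "d = m - j" "j \<le> m" by auto
  have "gen m ^ (r ^ d) - gen j \<in> I n n"
    using Suc.hyps(1)[OF d] d tower_ideal_mono[OF gens_in_mpolys gens_in_mpolys, of n n m m]
    by (auto simp: n)
  moreover have "gen n ^ r - gen m \<in> I n n"
    using tower_ideal_gens[OF gens_in_mpolys, of n n n] f_eq[of n] by (simp add: n gen_def)
  then have "(gen n ^ r) ^ (r ^ d) - gen m ^ (r ^ d) \<in> I n n"
    by (intro tower_ideal_power_diff gens_in_mpolys mpolys_power gen_in_mpolys) (auto simp: n)
  ultimately have "((gen n ^ r) ^ (r ^ d) - gen m ^ (r ^ d)) + (gen m ^ (r ^ d) - gen j) \<in> I n n"
    by (intro tower_ideal_add gens_in_mpolys) auto
  then show ?case by (simp add: Suc.hyps(2)[symmetric] power_mult)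
qed

lemma lift_in_mpolys: "poly (map_poly Const g) (gen n) \<in> mpolys n"
  by (induction g) (auto simp: Const_hom.map_poly_pCons_hom intro: gen_in_mpolys)

lemma ex_lift:
  assumes "h \<in> mpolys n"
  shows "\<exists>g. h - poly (map_poly Const g) (gen n) \<in> I n n"
  using assms
proof (induction h rule: mpolys_induct)
  case (Const c)
  have "Const c - poly (map_poly Const [:c:]) (gen n) = 0"
    by (simp add: Const_hom.map_poly_pCons_hom)
  then show ?case using tower_ideal_zero[OF gens_in_mpolys[of n n]] by (metis order_refl)
next
  case (add h h')
  then obtain g g' where g: "h - poly (map_poly Const g) (gen n) \<in> I n n"
    "h' - poly (map_poly Const g') (gen n) \<in> I n n" by blast
  have "h + h' - poly (map_poly Const (g + g')) (gen n)
      = (h - poly (map_poly Const g) (gen n)) + (h' - poly (map_poly Const g') (gen n))"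
    by (simp add: hom_distribs)
  then show ?case using tower_ideal_add[OF gens_in_mpolys g] by (metis order_refl)
next
  case (mult_Var h j)
  then obtain g where g: "h - poly (map_poly Const g) (gen n) \<in> I n n" by blast
  let ?g = "g * monom 1 (r ^ (n - j))" and ?l = "poly (map_poly Const g) (gen n)"
  have j: "gen j = Var j" using mult_Var.hyps by (auto simp: gen_def)
  have "poly (map_poly Const ?g) (gen n) = ?l * gen n ^ (r ^ (n - j))"
    by (simp add: Const_poly_hom.hom_mult poly_monom)
  then have "h * Var j - poly (map_poly Const ?g) (gen n)
      = (h - ?l) * Var j + (- ?l) * (gen n ^ (r ^ (n - j)) - gen j)"
    by (simp add: algebra_simps j)
  also have "\<dots> \<in> I n n"
    using mult_Var.hyps g gen_power_mem[of j n]
    by (intro tower_ideal_add tower_ideal_mult tower_ideal_mult_right gens_in_mpolys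
        mpolys_closed lift_in_mpolys) auto
  finally show ?case ..
qed

text \<open>
Rewriting all indeterminates as powers of \<open>X\<^sub>n\<close> leaves a polynomial in \<open>X\<^sub>n\<close> alone, and division by
\<open>Y ^ (r ^ n) - a\<close>, which vanishes at \<open>X\<^sub>n\<close> modulo the ideal, reduces its degree.
\<close>

lemma ex_reduced_lift:
  assumes "h \<in> mpolys n"
  shows "\<exists>g. h - poly (map_poly Const g) (gen n) \<in> I n n \<and> Polynomial.degree g < r ^ n"
proof -
  obtain g where g: "h - poly (map_poly Const g) (gen n) \<in> I n n" using ex_lift[OF assms] ..
  define m where "m = monom 1 (r ^ n) + [:- a:]"
  have pos: "r ^ n > 0" using prime_r by (simp add: prime_gt_0_nat)
  have deg: "Polynomial.degree m = r ^ n"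
    unfolding m_def using pos by (subst degree_add_eq_left) (auto simp: Polynomial.degree_monom_eq)
  let ?q = "poly (map_poly Const (g div m)) (gen n)"
  have lift_m: "poly (map_poly Const m) (gen n) = gen n ^ (r ^ n) - Const a"
    by (simp add: m_def Const_poly_hom.hom_add Const_hom.map_poly_pCons_hom poly_monom Const_hom.hom_uminus)
  have "g = g div m * m + g mod m" by (rule div_mult_mod_eq[symmetric])
  then have "poly (map_poly Const g) (gen n)
      = poly (map_poly Const (g div m * m + g mod m)) (gen n)" by simp
  also have "\<dots> = ?q * (gen n ^ (r ^ n) - Const a) + poly (map_poly Const (g mod m)) (gen n)"
    by (simp only: Const_poly_hom.hom_add Const_poly_hom.hom_mult poly_add poly_mult lift_m)
  finally have "h - poly (map_poly Const (g mod m)) (gen n)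
      = (h - poly (map_poly Const g) (gen n)) + ?q * (gen n ^ (r ^ (n - 0)) - gen 0)"
    by (simp add: gen_def)
  also have "\<dots> \<in> I n n"
    by (intro tower_ideal_add tower_ideal_mult gens_in_mpolys g gen_power_mem lift_in_mpolys) auto
  finally have "h - poly (map_poly Const (g mod m)) (gen n) \<in> I n n" .
  moreover have "Polynomial.degree (g mod m) < r ^ n"
    using degree_mod_less[of m g] deg pos Polynomial.degree_0 by (cases "m = 0"; cases "g mod m = 0") auto
  ultimately show ?thesis by blast
qed

lemma ex_poly_ev:
  assumes "h \<in> mpolys n"
  obtains g where "ev h = poly (map_poly to_ac g) (\<alpha> n)" "Polynomial.degree g < r ^ n"
proof -
  obtain g where g: "h - poly (map_poly Const g) (gen n) \<in> I n n" "Polynomial.degree g < r ^ n"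
    using ex_reduced_lift[OF assms] by blast
  from ev_tower_ideal[OF _ g(1)] have "ev h = poly (map_poly to_ac g) (\<alpha> n)"
    by (simp add: ev.hom_minus to_ac_hom.eval_mpoly_poly_Const)
  with g(2) that show thesis by blast
qed

text \<open>
The reduced representative of \<open>h\<close> is a relation for \<open>\<alpha> n\<close> of degree less than \<open>r ^ n\<close>, hence zero.
So \<open>F\<^sub>n\<close> is the subring \<open>F[\<alpha> n]\<close> of the algebraic closure.
\<close>

lemma ev_eq_0_imp_mem_tower_ideal:
  assumes "h \<in> mpolys n" "ev h = 0"
  shows "h \<in> I n n"
proof -
  obtain g where g: "h - poly (map_poly Const g) (gen n) \<in> I n n" "Polynomial.degree g < r ^ n"
    using ex_reduced_lift[OF assms(1)] by blast
  from ev_tower_ideal[OF _ g(1)] have "poly (map_poly to_ac g) (\<alpha> n) = 0"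
    by (simp add: ev.hom_minus to_ac_hom.eval_mpoly_poly_Const assms(2))
  then have g0: "g = 0" using g(2) by (rule no_small_relation)
  from g(1) show ?thesis unfolding g0 map_poly_0 poly_0 diff_zero .
qed

lemma mem_tower_ideal_iff: "h \<in> I n n \<longleftrightarrow> h \<in> mpolys n \<and> ev h = 0"
proof
  assume h: "h \<in> I n n"
  show "h \<in> mpolys n \<and> ev h = 0"
  proof
    show "h \<in> mpolys n" by (rule tower_ideal_mem[OF gens_in_mpolys[OF order_refl] h])
    show "ev h = 0" by (rule ev_tower_ideal[OF order_refl h])
  qed
next
  assume h: "h \<in> mpolys n \<and> ev h = 0"
  show "h \<in> I n n"
    by (rule ev_eq_0_imp_mem_tower_ideal) (use h in simp_all)
qed

text \<open>
The values of \<open>ev\<close> form a finite integral domain, on which multiplication by a nonzero element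
is injective and therefore surjective.
\<close>

lemma ex_inverse_ev:
  assumes "h \<in> mpolys n" "ev h \<noteq> 0"
  shows "\<exists>h'\<in>mpolys n. ev (h * h') = 1"
proof -
  let ?S = "ev ` mpolys n"
  have "?S \<subseteq> (\<lambda>g. poly (map_poly to_ac g) (\<alpha> n)) ` {g. Polynomial.degree g < r ^ n}"
    by (auto elim: ex_poly_ev)
  then have "finite ?S"
    by (rule finite_subset) (intro finite_imageI finite_polys_degree_less)
  moreover have "(*) (ev h) ` ?S \<subseteq> ?S"
    using assms(1) by (auto simp flip: ev.hom_mult)
  moreover have "inj_on ((*) (ev h)) ?S"
    using assms(2) by (auto intro: inj_onI)
  ultimately have "(*) (ev h) ` ?S = ?S" by (rule endo_inj_surj)
  moreover have "1 \<in> ?S"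
    by (rule image_eqI[of _ _ 1]) auto
  ultimately have "1 \<in> (*) (ev h) ` ?S" by simp
  then obtain h' where "h' \<in> mpolys n" "1 = ev h * ev h'" by blast
  then show ?thesis by (intro bexI[of _ h']) (simp_all add: ev.hom_mult)
qed

text \<open>
The map \<open>F[X\<^sub>1, \<dots>, X\<^sub>n] \<rightarrow> F\<^bsub>n-1\<^esub>[Y]\<close> that keeps the last indeterminate free, with values read in the
polynomial ring over the algebraic closure.
\<close>

definition ev_last :: "nat \<Rightarrow> 'p mod_ring mpoly \<Rightarrow> 'p mod_ring alg_closure poly"
  where "ev_last n = eval_mpoly (\<lambda>c. [:to_ac c:]) (\<lambda>j. if j = n then [:0, 1:] else [:\<alpha> j:])"

lemma comm_ring_hom_pCons_to_ac:
  "comm_ring_hom (\<lambda>c::'p mod_ring. [:to_ac c:])"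
  by unfold_locales simp_all

lemma comm_ring_hom_ev_last: "comm_ring_hom (ev_last n)"
  unfolding ev_last_def
  by (rule comm_ring_hom.comm_ring_hom_eval_mpoly[OF comm_ring_hom_pCons_to_ac])

lemma ev_last_eq_ev:
  assumes "h \<in> mpolys k" "k < n"
  shows "ev_last n h = [:ev h:]"
  using assms(1)
proof (induction h rule: mpolys_induct)
  case (Const c)
  show ?case
    by (simp add: ev_last_def comm_ring_hom.eval_mpoly_Const[OF comm_ring_hom_pCons_to_ac])
next
  case (add h h')
  then show ?case
    by (simp add: ev_last_def comm_ring_hom.eval_mpoly_add[OF comm_ring_hom_pCons_to_ac] ev.hom_add)
next
  case (mult_Var h j)
  then show ?case using assms(2)
    by (simp add: ev_last_def comm_ring_hom.eval_mpoly_mult[OF comm_ring_hom_pCons_to_ac]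
      comm_ring_hom.eval_mpoly_Var[OF comm_ring_hom_pCons_to_ac] ev.hom_mult)
qed

lemma ev_last_Var: "ev_last n (Var n) = [:0, 1:]"
  by (simp add: ev_last_def comm_ring_hom.eval_mpoly_Var[OF comm_ring_hom_pCons_to_ac])

lemma coeff_ev_last_poly:
  assumes "\<forall>k. coeff G k \<in> mpolys (n - 1)" "n > 0"
  shows "coeff (ev_last n (poly G (Var n))) k = ev (coeff G k)"
proof -
  interpret ev_last: comm_ring_hom "ev_last n" by (rule comm_ring_hom_ev_last)
  have "ev_last n (poly G (Var n)) = (\<Sum>i\<le>Polynomial.degree G. monom (ev (coeff G i)) i)"
    using assms by (simp add: poly_altdef ev_last.hom_sum ev_last.hom_mult ev_last.hom_power
        ev_last_Var ev_last_eq_ev[of _ "n - 1" n] monom_altdef)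
  then show ?thesis
    by (simp add: coeff_sum coeff_eq_0)
qed

text \<open>
All coefficients of \<open>h\<close> with respect to \<open>X\<^sub>n\<close> are evaluated to zero, so they lie in the ideal one
level below.
\<close>

lemma ev_last_eq_0_imp_mem_tower_ideal:
  assumes "h \<in> mpolys n" "n > 0" "ev_last n h = 0"
  shows "h \<in> I n (n - 1)"
proof -
  obtain G :: "'p mod_ring mpoly poly"
    where G: "\<forall>k. coeff G k \<in> mpolys (n - 1)" "h = poly G (Var n)"
    using ex_poly_in_last_Var[OF assms(1,2)] by blast
  have "coeff G k \<in> I n (n - 1)" for k
  proof -
    have "ev (coeff G k) = 0"
      using coeff_ev_last_poly[OF G(1) assms(2), of k] assms(3) G(2) by simp
    then have "coeff G k \<in> I (n - 1) (n - 1)"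
      using G(1) ev_eq_0_imp_mem_tower_ideal by blast
    then show ?thesis
      using tower_ideal_mono[OF gens_in_mpolys gens_in_mpolys, of "n - 1" n "n - 1" "n - 1"] by auto
  qed
  then show ?thesis
    unfolding G(2) poly_altdef using assms(2)
    by (intro tower_ideal_sum tower_ideal_mult_right gens_in_mpolys) auto
qed

lemma ev_last_f:
  assumes "i > 0" "i < n"
  shows "ev_last n (f i) = 0"
  using ev_last_eq_ev[OF f_in_mpolys[of i i], of n] assms ev_f by simp

lemma mem_tower_ideal_last_iff:
  assumes "n > 0"
  shows "h \<in> I n (n - 1) \<longleftrightarrow> h \<in> mpolys n \<and> ev_last n h = 0"
proof
  assume h: "h \<in> I n (n - 1)"
  have "I n (n - 1) \<subseteq> {h \<in> mpolys n. ev_last n h = 0}"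
    using assms f_in_mpolys ev_last_f
    by (intro tower_ideal_minimal gens_in_mpolys ideal_kernel comm_ring_hom_ev_last) auto
  with h show "h \<in> mpolys n \<and> ev_last n h = 0" by blast
next
  assume "h \<in> mpolys n \<and> ev_last n h = 0"
  then show "h \<in> I n (n - 1)"
    using assms by (intro ev_last_eq_0_imp_mem_tower_ideal) simp_all
qed

lemma ev_last_f_last: "n > 0 \<Longrightarrow> ev_last n (f n) \<noteq> 0"
proof
  assume n: "n > 0" and 0: "ev_last n (f n) = 0"
  interpret ev_last: comm_ring_hom "ev_last n" by (rule comm_ring_hom_ev_last)
  have "ev_last n (f n) = [:0, 1:] ^ r - [:\<alpha> (n - 1):]"
    using n ev_last_eq_ev[OF gen_in_mpolys[of "n - 1" "n - 1"], of n]
    by (simp add: f_eq ev_last.hom_minus ev_last.hom_power ev_last_Var)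
  moreover have "[:0, 1:] ^ r = (monom 1 r :: 'p mod_ring alg_closure poly)"
    by (simp add: monom_altdef)
  ultimately have "coeff (ev_last n (f n)) r = 1"
    using prime_gt_0_nat[OF prime_r] by (simp add: coeff_pCons split: nat.split)
  with 0 show False by simp
qed

text \<open>
Reduce exponents of \<open>X\<^sub>n\<close> modulo \<open>r\<close>, using that \<open>X\<^sub>n\<^sup>r\<close> is congruent to \<open>X\<^bsub>n-1\<^esub>\<close>.
\<close>

lemma ex_combination_of_powers:
  assumes "h \<in> mpolys n" "n > 0"
  shows "\<exists>c. (\<forall>j. c j \<in> mpolys (n - 1)) \<and> h - (\<Sum>j<r. c j * Var n ^ j) \<in> I n n"
proof -
  obtain G :: "'p mod_ring mpoly poly"
    where G: "\<forall>k. coeff G k \<in> mpolys (n - 1)" "h = poly G (Var n)"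
    using ex_poly_in_last_Var[OF assms] by blast
  define c where "c j = (\<Sum>k\<in>{k \<in> {..Polynomial.degree G}. k mod r = j}.
      coeff G k * gen (n - 1) ^ (k div r))" for j
  have c: "c j \<in> mpolys (n - 1)" for j
    unfolding c_def using G(1) gen_in_mpolys by auto
  have r: "r > 0" by (rule prime_gt_0_nat[OF prime_r])
  have "(\<Sum>j<r. c j * Var n ^ j)
      = (\<Sum>j<r. \<Sum>k\<in>{k \<in> {..Polynomial.degree G}. k mod r = j}.
          coeff G k * gen (n - 1) ^ (k div r) * Var n ^ (k mod r))"
    by (simp add: c_def sum_distrib_right)
  also have "\<dots> = (\<Sum>k\<le>Polynomial.degree G.
      coeff G k * gen (n - 1) ^ (k div r) * Var n ^ (k mod r))"
    using r by (intro sum.group) auto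
  finally have sum_eq: "(\<Sum>j<r. c j * Var n ^ j) = (\<Sum>k\<le>Polynomial.degree G.
      coeff G k * gen (n - 1) ^ (k div r) * Var n ^ (k mod r))" .
  have "h - (\<Sum>j<r. c j * Var n ^ j) = (\<Sum>k\<le>Polynomial.degree G.
      (coeff G k * Var n ^ (k mod r)) * ((Var n ^ r) ^ (k div r) - gen (n - 1) ^ (k div r)))"
  proof -
    have pow: "Var n ^ k = (Var n ^ r) ^ (k div r) * (Var n ^ (k mod r) :: 'p mod_ring mpoly)" for k
      by (simp flip: power_mult power_add)
    have "coeff G k * Var n ^ k - coeff G k * gen (n - 1) ^ (k div r) * Var n ^ (k mod r)
        = (coeff G k * Var n ^ (k mod r)) * ((Var n ^ r) ^ (k div r) - gen (n - 1) ^ (k div r))" for k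
      by (subst pow) (simp add: algebra_simps)
    then show ?thesis
      unfolding G(2) poly_altdef sum_eq sum_subtractf[symmetric] by simp
  qed
  also have "\<dots> \<in> I n n"
  proof (intro tower_ideal_sum tower_ideal_mult tower_ideal_power_diff gens_in_mpolys order_refl)
    show "Var n ^ r - gen (n - 1) \<in> I n n"
      using tower_ideal_gens[OF gens_in_mpolys, of n n n] f_eq[of n] assms(2) by simp
    show "coeff G k * Var n ^ (k mod r) \<in> mpolys n" for k
      using G(1) mpolys_mono[of "n - 1" n] assms(2) by (intro mpolys_closed mpolys_power) auto
  qed (use assms(2) in \<open>auto intro: gen_in_mpolys\<close>)
  finally show ?thesis using c by blast
qed

text \<open>
Each coefficient \<open>ev (c j)\<close> is a polynomial \<open>g j\<close> of degree less than \<open>r ^ (n - 1)\<close> in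
\<open>\<alpha> (n - 1) = \<alpha> n ^ r\<close>. The relation thus is a relation for \<open>\<alpha> n\<close> over the prime field, of degree
less than \<open>r ^ n\<close>, and it is trivial. The exponents \<open>q r + j\<close> with \<open>j < r\<close> are pairwise distinct,
so no two coefficients of the \<open>g j\<close> are merged and each of them is zero.
\<close>

lemma powers_independent:
  assumes "n > 0" and c: "\<And>j. j < r \<Longrightarrow> c j \<in> mpolys (n - 1)"
    and rel: "(\<Sum>j<r. ev (c j) * \<alpha> n ^ j) = 0" and "j < r"
  shows "ev (c j) = 0"
proof -
  define M where "M = r ^ (n - 1)"
  have r: "r > 0" by (rule prime_gt_0_nat[OF prime_r])
  have "\<exists>g. ev (c j) = poly (map_poly to_ac g) (\<alpha> (n - 1)) \<and> Polynomial.degree g < M"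
    if "j < r" for j
    using ex_poly_ev[OF c[OF that]] unfolding M_def by metis
  then obtain g where g: "\<And>j. j < r \<Longrightarrow> ev (c j) = poly (map_poly to_ac (g j)) (\<alpha> (n - 1))"
    "\<And>j. j < r \<Longrightarrow> Polynomial.degree (g j) < M" by metis
  define G where "G = (\<Sum>j<r. \<Sum>q<M. monom (coeff (g j) q) (q * r + j))"
  have rn: "r ^ n = M * r" unfolding M_def using \<open>n > 0\<close> by (simp add: power_eq_if)
  have less: "q * r + j < M * r" if "q < M" "j < r" for q j
  proof -
    have "q * r + j < Suc q * r" using that by simp
    also have "\<dots> \<le> M * r" using that by (intro mult_le_mono1) auto
    finally show ?thesis .
  qed
  have "Polynomial.degree G < r ^ n"
    unfolding G_def rn using r less M_def
    by (intro degree_sum_less le_less_trans[OF Polynomial.degree_monom_le]) auto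
  moreover have "poly (map_poly to_ac G) (\<alpha> n) = 0"
  proof -
    have an: "\<alpha> n ^ r = \<alpha> (n - 1)" using \<alpha>_Suc[of "n - 1"] \<open>n > 0\<close> by simp
    have "poly (map_poly to_ac G) (\<alpha> n)
        = (\<Sum>j<r. \<Sum>q<M. to_ac (coeff (g j) q) * \<alpha> n ^ (q * r + j))"
      by (simp add: G_def hom_distribs poly_sum poly_monom)
    also have "\<dots> = (\<Sum>j<r. (\<Sum>q<M. to_ac (coeff (g j) q) * \<alpha> (n - 1) ^ q) * \<alpha> n ^ j)"
      unfolding an[symmetric] by (simp add: sum_distrib_left power_add mult_ac flip: power_mult)
    also have "\<dots> = (\<Sum>j<r. ev (c j) * \<alpha> n ^ j)"
    proof (rule sum.cong)
      fix j assume "j \<in> {..<r}"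
      then have j: "j < r" by simp
      have "(\<Sum>q<M. to_ac (coeff (g j) q) * \<alpha> (n - 1) ^ q)
          = (\<Sum>q\<le>Polynomial.degree (g j). to_ac (coeff (g j) q) * \<alpha> (n - 1) ^ q)"
        using g(2)[OF j] by (intro sum.mono_neutral_right) (auto simp: coeff_eq_0)
      then show "(\<Sum>q<M. to_ac (coeff (g j) q) * \<alpha> (n - 1) ^ q) * \<alpha> n ^ j
          = ev (c j) * \<alpha> n ^ j"
        by (simp add: g(1)[OF j] poly_altdef)
    qed simp
    finally show ?thesis using rel by simp
  qed
  ultimately have "G = 0" by (rule no_small_relation[rotated])
  have "coeff (g j) q = 0" if "q < M" for q
  proof -
    have eq: "q' * r + j' = q * r + j \<longleftrightarrow> j' = j \<and> q' = q" if "j' < r" for j' q'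
    proof
      assume e: "q' * r + j' = q * r + j"
      have "(q' * r + j') mod r = j'" "(q' * r + j') div r = q'"
        "(q * r + j) mod r = j" "(q * r + j) div r = q"
        using that \<open>j < r\<close> by auto
      then show "j' = j \<and> q' = q" unfolding e by simp
    qed simp
    have "coeff G (q * r + j)
        = (\<Sum>j'<r. \<Sum>q'<M. if j' = j \<and> q' = q then coeff (g j') q' else 0)"
      unfolding G_def coeff_sum by (intro sum.cong refl) (simp add: eq)
    also have "\<dots> = (\<Sum>j'<r. if j' = j then coeff (g j) q else 0)"
      using that by (intro sum.cong refl) auto
    also have "\<dots> = coeff (g j) q" using \<open>j < r\<close> by simp
    finally show ?thesis by (simp add: \<open>G = 0\<close>)
  qed
  then have "g j = 0"
    using g(2)[OF \<open>j < r\<close>] by (metis leading_coeff_0_iff)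
  then show ?thesis by (simp add: g(1)[OF \<open>j < r\<close>])
qed

end

section \<open>Residue class rings and irreducibility\<close>

context
  fixes f :: "nat \<Rightarrow> 'a::comm_ring_1 mpoly" and n k :: nat
  assumes gens: "f ` {1..k} \<subseteq> mpolys n"
begin

lemma cring_tower_quot: "cring (tower_quot f n k)"
  unfolding tower_quot_def
  by (intro ideal.quotient_is_cring tower_ideal_is_ideal gens cring_mpoly_ring)

lemma carrier_tower_quot: "carrier (tower_quot f n k) = residue_class f n k ` mpolys n"
  unfolding tower_quot_def residue_class_def FactRing_def A_RCOSETS_def'
  by auto

lemma residue_class_hom: "residue_class f n k \<in> Ring.ring_hom (mpoly_ring n) (tower_quot f n k)"
proof -
  have "residue_class f n k = (+>\<^bsub>mpoly_ring n\<^esub>) (tower_ideal f n k)"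
    by (rule ext) (simp add: residue_class_def)
  then show ?thesis
    unfolding tower_quot_def using ideal.rcos_ring_hom[OF tower_ideal_is_ideal[OF gens]] by simp
qed

lemma residue_class_mult:
  assumes "g \<in> mpolys n" "h \<in> mpolys n"
  shows "residue_class f n k g \<otimes>\<^bsub>tower_quot f n k\<^esub> residue_class f n k h = residue_class f n k (g * h)"
  using ring_hom_mult[OF residue_class_hom assms] by simp

lemma residue_class_add:
  assumes "g \<in> mpolys n" "h \<in> mpolys n"
  shows "residue_class f n k g \<oplus>\<^bsub>tower_quot f n k\<^esub> residue_class f n k h = residue_class f n k (g + h)"
  using ring_hom_add[OF residue_class_hom assms] by simp

lemma one_tower_quot: "\<one>\<^bsub>tower_quot f n k\<^esub> = residue_class f n k 1"
  using ring_hom_one[OF residue_class_hom] by simp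

lemma zero_tower_quot: "\<zero>\<^bsub>tower_quot f n k\<^esub> = residue_class f n k 0"
  using ring_hom_zero[OF residue_class_hom cring.axioms(1)[OF cring_mpoly_ring]
      cring.axioms(1)[OF cring_tower_quot]] by simp

lemma residue_class_in_carrier: "g \<in> mpolys n \<Longrightarrow> residue_class f n k g \<in> carrier (tower_quot f n k)"
  by (simp add: carrier_tower_quot)

lemma residue_class_eq_iff:
  assumes "g \<in> mpolys n" "h \<in> mpolys n"
  shows "residue_class f n k g = residue_class f n k h \<longleftrightarrow> g - h \<in> tower_ideal f n k"
  using ring.quotient_eq_iff_same_a_r_cos[OF cring.axioms(1)[OF cring_mpoly_ring]
      tower_ideal_is_ideal[OF gens] assms] assms
  by (simp add: residue_class_def)

end

lemma primeideal_kernel: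
  fixes h :: "'a::comm_ring_1 mpoly \<Rightarrow> 'b::idom"
  assumes "comm_ring_hom h"
  shows "primeideal {f \<in> mpolys n. h f = 0} (mpoly_ring n)"
proof -
  interpret comm_ring_hom h by fact
  show ?thesis
  proof (rule primeidealI[OF ideal_kernel[OF assms] cring_mpoly_ring])
    have "(1 :: 'a mpoly) \<in> mpolys n" "1 \<notin> {f \<in> mpolys n. h f = 0}" by simp_all
    then show "mpolys n \<noteq> {f \<in> mpolys n. h f = 0}" by blast
  qed (auto simp: hom_mult)
qed

context mpoly_tower
begin

interpretation ev: comm_ring_hom ev
  by (rule to_ac_hom.comm_ring_hom_eval_mpoly)

lemma domain_tower_quot: "n > 0 \<Longrightarrow> domain (tower_quot f n (n - 1))"
proof -
  assume n: "n > 0"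
  have "I n (n - 1) = {h \<in> mpolys n. ev_last n h = 0}"
    using mem_tower_ideal_last_iff[OF n] by (intro Set.set_eqI) simp
  then have "primeideal (I n (n - 1)) (mpoly_ring n)"
    using primeideal_kernel[OF comm_ring_hom_ev_last[of n], of n] by (simp only:)
  then show ?thesis
    unfolding tower_quot_def by (rule primeideal.quotient_is_domain)
qed

text \<open>
The polynomials \<open>g\<close> that admit such a \<open>q\<close> form an ideal, and it contains \<open>f\<^sub>1, \<dots>, f\<^sub>n\<close>.
\<close>

lemma mem_tower_ideal_imp_multiple:
  assumes "n > 0" "g \<in> I n n"
  shows "\<exists>q\<in>mpolys n. g - q * f n \<in> I n (n - 1)"
proof -
  let ?J = "{g \<in> mpolys n. \<exists>q\<in>mpolys n. g - q * f n \<in> I n (n - 1)}"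
  have gens: "f ` {1..n - 1} \<subseteq> mpolys n" by (rule gens_in_mpolys) simp
  have "ideal ?J (mpoly_ring n)"
  proof (rule mpoly_idealI)
    show "0 \<in> ?J" using tower_ideal_zero[OF gens] by (auto intro!: bexI[of _ 0])
    fix x y assume "x \<in> ?J" "y \<in> ?J"
    then obtain q q' where q: "q \<in> mpolys n" "q' \<in> mpolys n" "x \<in> mpolys n" "y \<in> mpolys n"
      "x - q * f n \<in> I n (n - 1)" "y - q' * f n \<in> I n (n - 1)" by blast
    from tower_ideal_add[OF gens q(5,6)] have "x + y - (q + q') * f n \<in> I n (n - 1)"
      by (simp add: algebra_simps)
    then show "x + y \<in> ?J" using q by (auto intro!: bexI[of _ "q + q'"])
  next
    fix g x :: "'p mod_ring mpoly" assume g: "g \<in> mpolys n" and "x \<in> ?J"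
    then obtain q where q: "q \<in> mpolys n" "x \<in> mpolys n" "x - q * f n \<in> I n (n - 1)" by blast
    from tower_ideal_mult[OF gens g q(3)] have "g * x - (g * q) * f n \<in> I n (n - 1)"
      by (simp add: algebra_simps)
    then show "g * x \<in> ?J" using q g by (auto intro!: bexI[of _ "g * q"])
  qed auto
  moreover have "f j \<in> ?J" if j: "j \<in> {1..n}" for j
  proof (cases "j = n")
    case True
    then show ?thesis
      using f_in_mpolys[of n n] \<open>n > 0\<close> tower_ideal_zero[OF gens] by (auto intro!: bexI[of _ 1])
  next
    case False
    with j have "f j \<in> I n (n - 1)" by (intro tower_ideal_gens[OF gens]) auto
    then show ?thesis
      using tower_ideal_mem[OF gens] by (auto intro!: bexI[of _ 0])
  qed
  ultimately have "I n n \<subseteq> ?J"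
    by (intro tower_ideal_minimal gens_in_mpolys) auto
  then show ?thesis using assms(2) by blast
qed

text \<open>
If \<open>f n\<close> is congruent to \<open>g h\<close>, evaluation at the roots shows that one factor, say \<open>g\<close>, lies in
the kernel \<open>(f\<^sub>1, \<dots>, f\<^sub>n)\<close>. Then \<open>g\<close> is congruent to a multiple \<open>q f\<^sub>n\<close>, and cancelling \<open>f\<^sub>n\<close> in the
domain \<open>F\<^bsub>n-1\<^esub>[Y]\<close> makes \<open>h\<close> a unit with inverse \<open>q\<close>.
\<close>

lemma ring_irreducible_residue_class:
  assumes n: "n > 0" and m: "m = n - 1"
  shows "ring_irreducible\<^bsub>tower_quot f n m\<^esub> (residue_class f n m (f n))"
proof -
  let ?Q = "tower_quot f n m" and ?c = "residue_class f n m"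
  interpret Q: domain ?Q by (rule domain_tower_quot[OF n, folded m])
  interpret ev_last: comm_ring_hom "ev_last n" by (rule comm_ring_hom_ev_last)
  have gens: "f ` {1..m} \<subseteq> mpolys n" by (rule gens_in_mpolys) (simp add: m)
  note last_iff = mem_tower_ideal_last_iff[OF n, folded m]
  have fn: "f n \<in> mpolys n" using n by (intro f_in_mpolys) auto
  note rep = carrier_tower_quot[OF gens]
  have factor_unit: "?c h \<in> Units ?Q"
    if g: "g \<in> mpolys n" "g \<in> I n n" and h: "h \<in> mpolys n" and fgh: "f n - g * h \<in> I n m" for g h
  proof -
    obtain q where q: "q \<in> mpolys n" "g - q * f n \<in> I n m"
      using mem_tower_ideal_imp_multiple[OF n g(2), folded m] by blast
    have g': "ev_last n g = ev_last n q * ev_last n (f n)"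
      using q(2) last_iff by (simp add: ev_last.hom_minus ev_last.hom_mult)
    have fgh': "ev_last n (f n) = ev_last n g * ev_last n h"
      using fgh last_iff by (simp add: ev_last.hom_minus ev_last.hom_mult)
    have "ev_last n (f n) * (ev_last n q * ev_last n h) = (ev_last n q * ev_last n (f n)) * ev_last n h"
      by (simp only: mult_ac)
    also have "\<dots> = ev_last n (f n) * 1"
      by (simp only: g'[symmetric] fgh'[symmetric] mult_1_right)
    finally have "ev_last n (f n) * (ev_last n q * ev_last n h) = ev_last n (f n) * 1" .
    then have "ev_last n q * ev_last n h = 1"
      unfolding mult_left_cancel[OF ev_last_f_last[OF n]] .
    then have "q * h - 1 \<in> I n m"
      using q(1) h last_iff by (simp add: ev_last.hom_minus ev_last.hom_mult)
    then have "?c q \<otimes>\<^bsub>?Q\<^esub> ?c h = \<one>\<^bsub>?Q\<^esub>"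
      using q(1) h by (simp add: residue_class_mult[OF gens] one_tower_quot[OF gens] residue_class_eq_iff[OF gens])
    moreover have "?c h \<in> carrier ?Q" "?c q \<in> carrier ?Q"
      using h q(1) by (simp_all add: residue_class_in_carrier[OF gens])
    ultimately show ?thesis
      using Q.m_comm[of "?c q" "?c h"] unfolding Units_def mem_Collect_eq
      by (intro conjI bexI[of _ "?c q"]) simp_all
  qed
  show ?thesis
  proof (rule Q.ring_irreducibleI)
    have "f n \<notin> I n m"
      using ev_last_f_last[OF n] last_iff by simp
    then show "?c (f n) \<in> carrier ?Q - {\<zero>\<^bsub>?Q\<^esub>}"
      using fn by (simp add: rep zero_tower_quot[OF gens] residue_class_eq_iff[OF gens])
    show "?c (f n) \<notin> Units ?Q"
    proof
      assume "?c (f n) \<in> Units ?Q"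
      then obtain x where "x \<in> carrier ?Q" "x \<otimes>\<^bsub>?Q\<^esub> ?c (f n) = \<one>\<^bsub>?Q\<^esub>"
        unfolding Units_def by blast
      then obtain g where g: "g \<in> mpolys n" "g * f n - 1 \<in> I n m"
        using fn by (auto simp: rep one_tower_quot[OF gens] residue_class_mult[OF gens]
            residue_class_eq_iff[OF gens])
      have "ev (g * f n - 1) = 0" by (rule ev_tower_ideal[OF _ g(2)]) (simp add: m)
      then show False using ev_f[OF n] by (simp add: ev.hom_minus ev.hom_mult)
    qed
    fix x y assume "x \<in> carrier ?Q" "y \<in> carrier ?Q" and xy: "?c (f n) = x \<otimes>\<^bsub>?Q\<^esub> y"
    then obtain g h where g: "g \<in> mpolys n" "x = ?c g" and h: "h \<in> mpolys n" "y = ?c h"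
      by (auto simp: rep)
    have fgh: "f n - g * h \<in> I n m"
      using xy g h fn by (simp add: residue_class_mult[OF gens] residue_class_eq_iff[OF gens])
    have "ev (f n - g * h) = 0" by (rule ev_tower_ideal[OF _ fgh]) (simp add: m)
    then have "ev g = 0 \<or> ev h = 0"
      using ev_f[OF n] by (simp add: ev.hom_minus ev.hom_mult)
    then show "x \<in> Units ?Q \<or> y \<in> Units ?Q"
    proof
      assume "ev g = 0"
      then show ?thesis
        using factor_unit[OF g(1) ev_eq_0_imp_mem_tower_ideal[OF g(1)] h(1) fgh] h(2) by simp
    next
      assume "ev h = 0"
      moreover have "f n - h * g \<in> I n m" using fgh by (simp add: mult.commute)
      ultimately show ?thesis
        using factor_unit[OF h(1) ev_eq_0_imp_mem_tower_ideal[OF h(1)] g(1)] g(2) by simp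
    qed
  qed
qed

section \<open>The fields of the tower and the degrees of its steps\<close>

lemma residue_class_eq_iff_ev:
  assumes "g \<in> mpolys n" "h \<in> mpolys n"
  shows "residue_class f n n g = residue_class f n n h \<longleftrightarrow> ev g = ev h"
  using residue_class_eq_iff[OF gens_in_mpolys[OF order_refl] assms] assms
  by (simp add: mem_tower_ideal_iff ev.hom_minus)

lemma field_tower_quot: "field (tower_quot f n n)"
proof -
  note gens = gens_in_mpolys[OF order_refl, of n]
  interpret Q: cring "tower_quot f n n" by (rule cring_tower_quot[OF gens])
  show ?thesis
  proof (rule Q.cring_fieldI2)
    show "\<zero>\<^bsub>tower_quot f n n\<^esub> \<noteq> \<one>\<^bsub>tower_quot f n n\<^esub>"
      by (simp add: zero_tower_quot[OF gens] one_tower_quot[OF gens] residue_class_eq_iff_ev)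
    fix x assume "x \<in> carrier (tower_quot f n n)" "x \<noteq> \<zero>\<^bsub>tower_quot f n n\<^esub>"
    then obtain h where h: "h \<in> mpolys n" "x = residue_class f n n h"
      by (auto simp: carrier_tower_quot[OF gens])
    then have "ev h \<noteq> 0"
      using \<open>x \<noteq> _\<close> by (simp add: zero_tower_quot[OF gens] residue_class_eq_iff_ev)
    then obtain h' where "h' \<in> mpolys n" "ev (h * h') = 1"
      using ex_inverse_ev[OF h(1)] by blast
    then show "\<exists>y\<in>carrier (tower_quot f n n). x \<otimes>\<^bsub>tower_quot f n n\<^esub> y = \<one>\<^bsub>tower_quot f n n\<^esub>"
      using h by (intro bexI[of _ "residue_class f n n h'"])
        (simp_all add: residue_class_mult[OF gens] one_tower_quot[OF gens] residue_class_eq_iff_ev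
          residue_class_in_carrier[OF gens])
  qed
qed

text \<open>
The inverse of an element of the image of \<open>F\<^bsub>n-1\<^esub>\<close> already exists one level below.
\<close>

lemma subfield_tower_subfield:
  "subfield (tower_subfield f n) (tower_quot f n n)"
proof -
  note gens = gens_in_mpolys[OF order_refl, of n]
  let ?Q = "tower_quot f n n" and ?c = "residue_class f n n"
  interpret Q: field ?Q by (rule field_tower_quot)
  have sub: "g \<in> mpolys n" if "g \<in> mpolys (n - 1)" for g :: "'p mod_ring mpoly"
    using that mpolys_mono[of "n - 1" n] by auto
  note [simp] = residue_class_mult[OF gens] residue_class_add[OF gens] one_tower_quot[OF gens]
    zero_tower_quot[OF gens] residue_class_eq_iff_ev residue_class_in_carrier[OF gens] sub
  show ?thesis
  proof (rule Q.subfieldI')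
    show "subring (tower_subfield f n) ?Q"
    proof (rule Q.subringI)
      show "tower_subfield f n \<subseteq> carrier ?Q" by (auto simp: tower_subfield_def)
      show "\<one>\<^bsub>?Q\<^esub> \<in> tower_subfield f n" by (auto simp: tower_subfield_def)
    next
      fix x assume "x \<in> tower_subfield f n"
      then obtain g where g: "g \<in> mpolys (n - 1)" "x = ?c g" by (auto simp: tower_subfield_def)
      have "\<ominus>\<^bsub>?Q\<^esub> x = ?c (- g)"
        using g by (intro Q.minus_equality) simp_all
      then show "\<ominus>\<^bsub>?Q\<^esub> x \<in> tower_subfield f n" using g by (auto simp: tower_subfield_def)
    next
      fix x y assume "x \<in> tower_subfield f n" "y \<in> tower_subfield f n"
      then obtain g h where g: "g \<in> mpolys (n - 1)" "x = ?c g" "h \<in> mpolys (n - 1)" "y = ?c h"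
        by (auto simp: tower_subfield_def)
      then show "x \<otimes>\<^bsub>?Q\<^esub> y \<in> tower_subfield f n" "x \<oplus>\<^bsub>?Q\<^esub> y \<in> tower_subfield f n"
        unfolding tower_subfield_def by simp_all
    qed
    fix x assume x: "x \<in> tower_subfield f n - {\<zero>\<^bsub>?Q\<^esub>}"
    then obtain g where g: "g \<in> mpolys (n - 1)" "x = ?c g"
      by (auto simp: tower_subfield_def)
    then have "ev g \<noteq> 0" using x by simp
    then obtain h where h: "h \<in> mpolys (n - 1)" "ev (g * h) = 1"
      using ex_inverse_ev[OF g(1)] by blast
    have "inv\<^bsub>?Q\<^esub> x = ?c h"
      using g h by (intro Q.inv_char) (simp_all add: mult.commute)
    then show "inv\<^bsub>?Q\<^esub> x \<in> tower_subfield f n" using h by (auto simp: tower_subfield_def)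
  qed
qed

text \<open>
The span of \<open>1, X\<^sub>n, \<dots>, X\<^sub>n\<^bsup>k-1\<^esup>\<close> over \<open>F\<^bsub>n-1\<^esub>\<close>. The coefficients are total functions, so that the
span for \<open>k + 1\<close> arises from that for \<open>k\<close> by updating one coefficient.
\<close>

definition combinations :: "nat \<Rightarrow> nat \<Rightarrow> 'p mod_ring mpoly set set"
  where "combinations n k =
    {residue_class f n n (\<Sum>j<k. c j * Var n ^ j) | c. \<forall>j. c j \<in> mpolys (n - 1)}"

text \<open>
Adjoining \<open>X\<^sub>n\<^sup>k\<close> enlarges the span as long as \<open>k < r\<close>: a relation expressing it by lower powers
would contradict their independence.
\<close>

lemma dimension_combinations:
  assumes "n > 0" "k \<le> r"
  shows "ring.dimension (tower_quot f n n) k (tower_subfield f n) (combinations n k)"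
  using assms(2)
proof (induction k)
  note gens = gens_in_mpolys[OF order_refl, of n]
  let ?Q = "tower_quot f n n" and ?c = "residue_class f n n"
  interpret Q: field ?Q by (rule field_tower_quot)
  case 0
  have "combinations n 0 = {\<zero>\<^bsub>?Q\<^esub>}"
    by (auto simp: combinations_def zero_tower_quot[OF gens] intro: exI[of _ "\<lambda>_. 0"])
  then show ?case by simp
next
  note gens = gens_in_mpolys[OF order_refl, of n]
  let ?Q = "tower_quot f n n" and ?c = "residue_class f n n"
  interpret Q: field ?Q by (rule field_tower_quot)
  case (Suc k)
  have sub: "g \<in> mpolys n" if "g \<in> mpolys (n - 1)" for g :: "'p mod_ring mpoly"
    using that mpolys_mono[of "n - 1" n] by auto
  have var: "Var n ^ j \<in> (mpolys n :: 'p mod_ring mpoly set)" for j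
    using assms(1) by (intro mpolys_power) simp
  let ?v = "?c (Var n ^ k)"
  have "?v \<notin> combinations n k"
  proof
    assume "?v \<in> combinations n k"
    then obtain c where c: "\<And>j. c j \<in> mpolys (n - 1)" "?v = ?c (\<Sum>j<k. c j * Var n ^ j)"
      by (auto simp: combinations_def)
    then have "ev (Var n ^ k) = ev (\<Sum>j<k. c j * Var n ^ j)"
      using var sub by (subst (asm) residue_class_eq_iff_ev) auto
    then have eq: "\<alpha> n ^ k = (\<Sum>j<k. ev (c j) * \<alpha> n ^ j)"
      by (simp add: ev.hom_sum ev.hom_mult ev.hom_power)
    \<comment> \<open>The coefficients of the forbidden relation, padded with zeros up to \<open>r\<close> terms.\<close>
    define c' where "c' j = (if j < k then c j else if j = k then - 1 else 0)" for j
    have "(\<Sum>j<r. ev (c' j) * \<alpha> n ^ j) = (\<Sum>j<Suc k. ev (c' j) * \<alpha> n ^ j)"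
      using Suc.prems by (intro sum.mono_neutral_right) (auto simp: c'_def)
    also have "\<dots> = 0" by (simp add: c'_def eq ev.hom_uminus)
    finally have "ev (c' k) = 0"
      using Suc.prems c(1) by (intro powers_independent[OF assms(1)]) (auto simp: c'_def)
    then show False by (simp add: c'_def ev.hom_uminus)
  qed
  then have dim: "Q.dimension (Suc k) (tower_subfield f n)
      (Q.line_extension (tower_subfield f n) ?v (combinations n k))"
    using Suc var by (intro Q.Suc_dim) (auto simp: residue_class_in_carrier[OF gens])
  have "Q.line_extension (tower_subfield f n) ?v (combinations n k) = combinations n (Suc k)"
  proof (intro Set.set_eqI iffI)
    fix x assume "x \<in> Q.line_extension (tower_subfield f n) ?v (combinations n k)"
    then obtain g c where g: "g \<in> mpolys (n - 1)" and c: "\<And>j. c j \<in> mpolys (n - 1)"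
      and x: "x = ?c g \<otimes>\<^bsub>?Q\<^esub> ?v \<oplus>\<^bsub>?Q\<^esub> ?c (\<Sum>j<k. c j * Var n ^ j)"
      by (auto simp: Q.line_extension_mem_iff tower_subfield_def combinations_def)
    have "x = ?c (g * Var n ^ k + (\<Sum>j<k. c j * Var n ^ j))"
      unfolding x using g c var sub by (simp add: residue_class_mult[OF gens] residue_class_add[OF gens])
    also have "g * Var n ^ k + (\<Sum>j<k. c j * Var n ^ j) = (\<Sum>j<Suc k. (c(k := g)) j * Var n ^ j)"
      by (simp add: add.commute)
    finally show "x \<in> combinations n (Suc k)"
      unfolding combinations_def using g c by (auto intro!: exI[of _ "c(k := g)"])
  next
    fix x assume "x \<in> combinations n (Suc k)"
    then obtain c where c: "\<And>j. c j \<in> mpolys (n - 1)" "x = ?c (\<Sum>j<Suc k. c j * Var n ^ j)"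
      by (auto simp: combinations_def)
    have "x = ?c (c k) \<otimes>\<^bsub>?Q\<^esub> ?v \<oplus>\<^bsub>?Q\<^esub> ?c (\<Sum>j<k. c j * Var n ^ j)"
      unfolding c(2) using c(1) var sub
      by (simp add: residue_class_mult[OF gens] residue_class_add[OF gens] add.commute)
    then show "x \<in> Q.line_extension (tower_subfield f n) ?v (combinations n k)"
      using c(1) unfolding Q.line_extension_mem_iff tower_subfield_def combinations_def by blast
  qed
  with dim show ?case by simp
qed

lemma combinations_eq_carrier:
  assumes "n > 0"
  shows "combinations n r = carrier (tower_quot f n n)"
proof -
  note gens = gens_in_mpolys[OF order_refl, of n]
  have sub: "g \<in> mpolys n" if "g \<in> mpolys (n - 1)" for g :: "'p mod_ring mpoly"
    using that mpolys_mono[of "n - 1" n] by auto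
  have in_n: "(\<Sum>j<r. c j * Var n ^ j) \<in> mpolys n"
    if "\<And>j. c j \<in> mpolys (n - 1)" for c :: "nat \<Rightarrow> 'p mod_ring mpoly"
    using that sub assms by (intro mpolys_sum mpolys_closed mpolys_power) auto
  show ?thesis
  proof (intro Set.set_eqI iffI)
    fix x assume "x \<in> combinations n r"
    then show "x \<in> carrier (tower_quot f n n)"
      using in_n by (auto simp: combinations_def intro!: residue_class_in_carrier[OF gens])
  next
    fix x assume "x \<in> carrier (tower_quot f n n)"
    then obtain h where h: "h \<in> mpolys n" "x = residue_class f n n h"
      by (auto simp: carrier_tower_quot[OF gens])
    then obtain c where c: "\<forall>j. c j \<in> mpolys (n - 1)" "h - (\<Sum>j<r. c j * Var n ^ j) \<in> I n n"
      using ex_combination_of_powers[OF h(1) assms] by blast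
    then have "x = residue_class f n n (\<Sum>j<r. c j * Var n ^ j)"
      using h in_n by (simp add: residue_class_eq_iff[OF gens])
    with c(1) show "x \<in> combinations n r" by (auto simp: combinations_def)
  qed
qed

lemma tower_step_degree_r: "n > 0 \<Longrightarrow> tower_step_degree f n r"
  unfolding tower_step_degree_def
  using field_tower_quot subfield_tower_subfield dimension_combinations[of n r]
  by (simp add: combinations_eq_carrier)

lemma monic_f: "n > 0 \<Longrightarrow> monic_in n (f n)"
  unfolding f_eq using prime_gt_0_nat[OF prime_r]
  by (intro monic_in_Var_power_diff)
    (auto simp: gen_def Const_def Var_def lookup_single when_def split: if_splits)

lemma tower_of_field_extensions_f: "tower_of_field_extensions l f"
  unfolding tower_of_field_extensions_def
  by (auto intro!: f_in_mpolys monic_f ring_irreducible_residue_class)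

end

lemma ex_iterated_roots:
  assumes "r > 0"
  shows "\<exists>\<alpha>. \<alpha> 0 = x \<and> (\<forall>n. \<alpha> (Suc n) ^ r = (\<alpha> n :: 'a::alg_closed_field))"
proof -
  have "\<exists>y. y ^ r = x" for x :: 'a
    using nth_root_exists[OF assms, of x] by blast
  then show ?thesis
    using dependent_nat_choice[of "\<lambda>n y. n = 0 \<longrightarrow> y = x" "\<lambda>n y z. z ^ r = y"] by auto
qed

theorem proposition5p3:
  fixes p r l :: nat
    and a :: "'p::prime_card mod_ring"
    and f :: "nat \<Rightarrow> 'p mod_ring mpoly"
  assumes "p = CARD('p)" and "Factorial_Ring.prime p" and "Factorial_Ring.prime r"
    and "r dvd p - 1"
    and "r = 2 \<Longrightarrow> 4 dvd p - 1"
    and "a = NonRthPower r"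
    and "f 1 = Var 1 ^ r - Const a"
    and "\<And>i. i \<ge> 2 \<Longrightarrow> f i = Var i ^ r - Var (i - 1)"
    and "l > 0"
  shows "tower_of_field_extensions l f \<and> (\<forall>i\<in>{1..l}. tower_step_degree f i r)"
proof -
  obtain \<alpha> where \<alpha>: "\<alpha> 0 = to_ac a" "\<And>n. \<alpha> (Suc n) ^ r = \<alpha> n"
    using ex_iterated_roots[OF prime_gt_0_nat[OF assms(3)], of "to_ac a"] by auto
  have "r dvd CARD('p) - 1" using assms(1,4) by simp
  from NonRthPower_correct[OF prime_ge_2_nat[OF assms(3)] this]
  interpret mpoly_tower r a \<alpha> f
    by unfold_locales (use assms \<alpha> in auto)
  show ?thesis
    using tower_of_field_extensions_f tower_step_degree_r by auto
qed

end
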